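(* Let $K$ be a number field of degree $n=s+2t$ over $\mathbb{Q}$ with exactly $s\geq1$ real embeddings and exactly $2t>0$ complex (non-real) embeddings, let $M_K=(\mathbb{H}^s\times\mathbb{C}^t)/\Gamma$ be an associated Oeljeklaus-Toma manifold, and let $L$ be its weight bundle, with its holomorphic Hermitian structure and Chern connection $\nabla=\nabla_0+\sqrt{-1}\,\theta^c$. Consider the form $\omega_0:=\sqrt{-1}\,\nabla^2$. Then $\omega_0$ is a semi-positive form, which can be written (after pullback to $\mathbb{H}^s\times\mathbb{C}^t$) in the standard coordinates $z_1,\dots,z_s,z_{s+1},\dots,z_{s+t}$ as $$\omega_0=\sqrt{-1}\,\partial\bar\partial\log\phi=\sqrt{-1}\sum_{i=1}^s\frac{dz_i\wedge d\bar z_i}{|\operatorname{Im} z_i|^2},\qquad \phi=\prod_{i=1}^s(\operatorname{Im} z_i)^{-1}.$$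
   Context: Oeljeklaus-Toma manifolds: let $\sigma_1,\dots,\sigma_s:K\to\mathbb{R}\subset\mathbb{C}$ be the real embeddings of $K$ and $\sigma_{s+1},\dots,\sigma_{s+2t}$ the non-real ones, ordered so that $\sigma_{s+t+j}=\overline{\sigma_{s+j}}$ for $j=1,\dots,t$. Let $\mathcal{O}_K$ be the ring of integers, $\mathcal{O}_K^*$ its group of units, $\mathcal{O}_K^{*,+}$ the group of units $u$ with $\sigma_i(u)>0$ for $i=1,\dots,s$, and $\mathbb{H}\subset\mathbb{C}$ the upper half-plane. The group $\mathcal{O}_K\rtimes\mathcal{O}_K^{*,+}$ acts freely on $\mathbb{H}^s\times\mathbb{C}^t$ by $T_a(z_i)=(z_i+\sigma_i(a))$, $a\in\mathcal{O}_K$, and $R_u(z_i)=(\sigma_i(u)z_i)$, $u\in\mathcal{O}_K^{*,+}$, $i=1,\dots,s+t$. Let $U\subset\mathcal{O}_K^{*,+}$ be an admissible subgroup, i.e. a subgroup of rank $s$ such that $\{(\log\sigma_1(u),\dots,\log\sigma_s(u)): u\in U\}$ is a full lattice in $\mathbb{R}^s$; then $\Gamma:=\mathcal{O}_K\rtimes U$ acts freely, properly discontinuously and cocompactly, and $M_K=(\mathbb{H}^s\times\mathbb{C}^t)/\Gamma$ is a compact complex manifold of dimension $s+t$, called an Oeljeklaus-Toma manifold. Lee form and weight bundle: the 1-form $\tilde\theta:=-d\log\prod_{i=1}^s\operatorname{Im} z_i$ on $\mathbb{H}^s\times\mathbb{C}^t$ is $\Gamma$-invariant, hence is the pullback of a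 closed 1-form $\theta$ on $M_K$, called the Lee form. Put $\theta^c:=I\theta$, where $I$ is the complex structure acting on 1-forms. Let $L$ be the trivial Hermitian complex line bundle on $M_K$ with trivial connection $\nabla_0$, equipped with the Hermitian connection $\nabla:=\nabla_0+\sqrt{-1}\,\theta^c$. Its $(0,1)$-part is $\nabla^{0,1}=\bar\partial+\theta^{0,1}$, where $\theta^{0,1}$ is the $(0,1)$-part of $\theta$, and it defines the holomorphic structure on $L$. The holomorphic Hermitian line bundle $L$ is called the weight bundle of $M_K$.
   Formalization: The displayed chain is false by constant factors, since ∂∂̄(−log Im z) = dz∧dz̄/(4(Im z)²) and i∇² = 2i∂∂̄ log φ; the formal theorem proves the corrected chain ω₀ = 2i∂∂̄ log φ = (i/2)Σ dz_i∧dz̄_i/|Im z_i|². *)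

theory Defs
  imports "HOL-Analysis.Analysis" "HOL-Computational_Algebra.Polynomial"
begin

section \<open>Differential forms on open subsets of complex coordinate space\<close>

text \<open>
  Forms are complex-valued; a 1-form sends a point and a tangent vector to a complex number, a
  2-form takes two tangent vectors. The complex structure on tangent vectors is \<open>v \<mapsto> \<i> *s v\<close>.
  Normalisation throughout: \<open>(\<alpha> \<and> \<beta>)(v,w) = \<alpha>(v)\<beta>(w) - \<alpha>(w)\<beta>(v)\<close>, and
  \<open>d\<alpha>(v,w) = v(\<alpha>(w)) - w(\<alpha>(v))\<close> for constant vector fields \<open>v\<close>, \<open>w\<close>.
\<close>

type_synonym 'n form0 = "complex^'n \<Rightarrow> complex"
type_synonym 'n form1 = "complex^'n \<Rightarrow> complex^'n \<Rightarrow> complex"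
type_synonym 'n form2 = "complex^'n \<Rightarrow> complex^'n \<Rightarrow> complex^'n \<Rightarrow> complex"

primrec Ck_on :: "nat \<Rightarrow> 'a::euclidean_space set \<Rightarrow> ('a \<Rightarrow> 'b::real_normed_vector) \<Rightarrow> bool" where
  "Ck_on 0 D f \<longleftrightarrow> continuous_on D f"
| "Ck_on (Suc k) D f \<longleftrightarrow>
     (\<forall>x\<in>D. f differentiable (at x)) \<and> (\<forall>v. Ck_on k D (\<lambda>x. frechet_derivative f (at x) v))"

definition smooth_on :: "'a::euclidean_space set \<Rightarrow> ('a \<Rightarrow> 'b::real_normed_vector) \<Rightarrow> bool" where
  "smooth_on D f \<longleftrightarrow> (\<forall>k. Ck_on k D f)"

definition extd0 :: "'n::finite form0 \<Rightarrow> 'n form1" where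
  "extd0 f z v = frechet_derivative f (at z) v"

definition extd1 :: "'n::finite form1 \<Rightarrow> 'n form2" where
  "extd1 \<alpha> z v w =
     frechet_derivative (\<lambda>x. \<alpha> x w) (at z) v - frechet_derivative (\<lambda>x. \<alpha> x v) (at z) w"

definition wedge :: "'n::finite form1 \<Rightarrow> 'n form1 \<Rightarrow> 'n form2" where
  "wedge \<alpha> \<beta> z v w = \<alpha> z v * \<beta> z w - \<alpha> z w * \<beta> z v"

definition dz :: "'n::finite \<Rightarrow> 'n form1" where
  "dz i = (\<lambda>_ v. v $ i)"

definition dzbar :: "'n::finite \<Rightarrow> 'n form1" where
  "dzbar i = (\<lambda>_ v. cnj (v $ i))"

text \<open>The components of type \<open>(0,1)\<close> of a 1-form and of type \<open>(1,1)\<close> of a 2-form.\<close>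

definition part01 :: "'n::finite form1 \<Rightarrow> 'n form1" where
  "part01 \<alpha> z v = (\<alpha> z v + \<i> * \<alpha> z (\<i> *s v)) / 2"

definition part11 :: "'n::finite form2 \<Rightarrow> 'n form2" where
  "part11 \<omega> z v w = (\<omega> z v w + \<omega> z (\<i> *s v) (\<i> *s w)) / 2"

definition dbar :: "'n::finite form0 \<Rightarrow> 'n form1" where
  "dbar f = part01 (extd0 f)"

text \<open>On a form \<open>\<beta>\<close> of type \<open>(0,1)\<close>, the operator \<open>\<partial>\<close> is the \<open>(1,1)\<close>-part of \<open>d\<beta>\<close>.\<close>

definition del01 :: "'n::finite form1 \<Rightarrow> 'n form2" where
  "del01 \<beta> = part11 (extd1 \<beta>)"


section \<open>Number fields, embeddings, admissible groups of units\<close>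

text \<open>
  The number field is the type \<open>'k\<close>. Since \<open>dim\<close> is 0 for spaces without a finite basis,
  a positive value of the degree implies that \<open>'k\<close> is finite over the rationals.
\<close>

definition rat_degree :: "'k::field_char_0 itself \<Rightarrow> nat" where
  "rat_degree _ = vector_space.dim (\<lambda>(q::rat) (x::'k). of_rat q * x) UNIV"

definition field_embedding :: "('k::field \<Rightarrow> complex) \<Rightarrow> bool" where
  "field_embedding f \<longleftrightarrow>
     f 1 = 1 \<and> (\<forall>x y. f (x + y) = f x + f y) \<and> (\<forall>x y. f (x * y) = f x * f y)"

text \<open>
  \<open>\<sigma> (Inl i)\<close> runs through the real embeddings; \<open>\<sigma> (Inr j)\<close> together with its conjugate runs
  through the non-real ones. In both cases every embedding is listed exactly once, so there are
  exactly \<open>CARD('s)\<close> real and exactly \<open>2 * CARD('t)\<close> non-real embeddings.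
\<close>

definition all_embeddings :: "('s::finite + 't::finite \<Rightarrow> 'k::field \<Rightarrow> complex) \<Rightarrow> bool" where
  "all_embeddings \<sigma> \<longleftrightarrow>
     bij_betw (\<lambda>i. \<sigma> (Inl i)) UNIV {f. field_embedding f \<and> range f \<subseteq> \<real>} \<and>
     bij_betw (case_sum (\<lambda>j. \<sigma> (Inr j)) (\<lambda>j. cnj \<circ> \<sigma> (Inr j))) (UNIV :: ('t + 't) set)
       {f. field_embedding f \<and> \<not> range f \<subseteq> \<real>}"

definition integers_of :: "'k::field_char_0 set" where
  "integers_of = {x. algebraic_int x}"

definition positive_units :: "('s::finite + 't::finite \<Rightarrow> 'k::field_char_0 \<Rightarrow> complex) \<Rightarrow> 'k set" where
  "positive_units \<sigma> = {u. u \<noteq> 0 \<and> u \<in> integers_of \<and> inverse u \<in> integers_of \<and>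
     (\<forall>i. Re (\<sigma> (Inl i) u) > 0)}"

definition mult_independent :: "'k::field set \<Rightarrow> bool" where
  "mult_independent B \<longleftrightarrow>
     (\<forall>k :: 'k \<Rightarrow> int. (\<Prod>b\<in>B. b powi k b) = 1 \<longrightarrow> (\<forall>b\<in>B. k b = 0))"

definition mult_rank_eq :: "'k::field set \<Rightarrow> nat \<Rightarrow> bool" where
  "mult_rank_eq U r \<longleftrightarrow>
     (\<exists>B\<subseteq>U. finite B \<and> mult_independent B \<and> card B = r) \<and>
     (\<forall>B\<subseteq>U. finite B \<and> mult_independent B \<longrightarrow> card B \<le> r)"

definition full_lattice :: "(real^'s::finite) set \<Rightarrow> bool" where
  "full_lattice \<Lambda> \<longleftrightarrow> (\<exists>B. independent B \<and> span B = UNIV \<and>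
     \<Lambda> = {\<Sum>b\<in>B. of_int (k b) *\<^sub>R b | k :: real^'s \<Rightarrow> int. True})"

definition admissible ::
  "('s::finite + 't::finite \<Rightarrow> 'k::field_char_0 \<Rightarrow> complex) \<Rightarrow> 'k set \<Rightarrow> bool" where
  "admissible \<sigma> U \<longleftrightarrow>
     U \<subseteq> positive_units \<sigma> \<and>
     1 \<in> U \<and> (\<forall>u\<in>U. \<forall>v\<in>U. u * v \<in> U) \<and> (\<forall>u\<in>U. inverse u \<in> U) \<and>
     mult_rank_eq U CARD('s) \<and>
     full_lattice ((\<lambda>u. \<chi> i. ln (Re (\<sigma> (Inl i) u))) ` U)"


section \<open>Oeljeklaus-Toma manifolds\<close>

text \<open>The space \<open>\<bbbH>\<^sup>s \<times> \<complex>\<^sup>t\<close>; the coordinate \<open>z\<^sub>i\<close> is \<open>z $ Inl i\<close> for \<open>i \<le> s\<close>, and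
  \<open>z\<^sub>s\<^sub>+\<^sub>j\<close> is \<open>z $ Inr j\<close>.\<close>

definition HC :: "(complex^('s::finite + 't::finite)) set" where
  "HC = {z. \<forall>i. Im (z $ Inl i) > 0}"

definition transl :: "('n::finite \<Rightarrow> 'k \<Rightarrow> complex) \<Rightarrow> 'k \<Rightarrow> complex^'n \<Rightarrow> complex^'n" where
  "transl \<sigma> a z = (\<chi> i. z $ i + \<sigma> i a)"

definition rot :: "('n::finite \<Rightarrow> 'k \<Rightarrow> complex) \<Rightarrow> 'k \<Rightarrow> complex^'n \<Rightarrow> complex^'n" where
  "rot \<sigma> u z = (\<chi> i. \<sigma> i u * z $ i)"

text \<open>\<open>(a,u)\<close> stands for the element of the semidirect product acting by \<open>T\<^sub>a \<circ> R\<^sub>u\<close>; the group law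
  is \<open>(a,u)(b,v) = (a + ub, uv)\<close>. The differential of the action is \<open>R\<^sub>u\<close> at every point.\<close>

definition ot_group :: "'k::field_char_0 set \<Rightarrow> ('k \<times> 'k) set" where
  "ot_group U = integers_of \<times> U"

definition ot_act :: "('n::finite \<Rightarrow> 'k \<Rightarrow> complex) \<Rightarrow> 'k \<times> 'k \<Rightarrow> complex^'n \<Rightarrow> complex^'n" where
  "ot_act \<sigma> g z = transl \<sigma> (fst g) (rot \<sigma> (snd g) z)"

definition ot_dact :: "('n::finite \<Rightarrow> 'k \<Rightarrow> complex) \<Rightarrow> 'k \<times> 'k \<Rightarrow> complex^'n \<Rightarrow> complex^'n" where
  "ot_dact \<sigma> g v = rot \<sigma> (snd g) v"

text \<open>
  Points of \<open>M\<close> are orbits in \<open>HC\<close>. The tangent bundle of the quotient is the quotient of the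
  tangent bundle \<open>HC \<times> \<complex>\<^sup>s\<^sup>+\<^sup>t\<close> by the induced action, so a tangent vector of \<open>M\<close> is an orbit of
  pairs \<open>(z,v)\<close>. \<open>ot_proj\<close> is the covering map and \<open>ot_dproj\<close> its differential; the local inverses
  of \<open>ot_proj\<close> are the holomorphic charts of \<open>M\<close>.
\<close>

type_synonym 'n ot_point = "(complex^'n) set"
type_synonym 'n ot_vector = "((complex^'n) \<times> (complex^'n)) set"
type_synonym 'n ot_form0 = "'n ot_point \<Rightarrow> complex"
type_synonym 'n ot_form1 = "'n ot_point \<Rightarrow> 'n ot_vector \<Rightarrow> complex"
type_synonym 'n ot_form2 = "'n ot_point \<Rightarrow> 'n ot_vector \<Rightarrow> 'n ot_vector \<Rightarrow> complex"

definition ot_proj ::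
  "('n::finite \<Rightarrow> 'k::field_char_0 \<Rightarrow> complex) \<Rightarrow> 'k set \<Rightarrow> complex^'n \<Rightarrow> 'n ot_point" where
  "ot_proj \<sigma> U z = (\<lambda>g. ot_act \<sigma> g z) ` ot_group U"

definition ot_dproj ::
  "('n::finite \<Rightarrow> 'k::field_char_0 \<Rightarrow> complex) \<Rightarrow> 'k set \<Rightarrow> complex^'n \<Rightarrow> complex^'n \<Rightarrow> 'n ot_vector"
  where
  "ot_dproj \<sigma> U z v = (\<lambda>g. (ot_act \<sigma> g z, ot_dact \<sigma> g v)) ` ot_group U"

definition ot_manifold ::
  "('s::finite + 't::finite \<Rightarrow> 'k::field_char_0 \<Rightarrow> complex) \<Rightarrow> 'k set \<Rightarrow> ('s + 't) ot_point set" where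
  "ot_manifold \<sigma> U = ot_proj \<sigma> U ` HC"

definition ot_tangent ::
  "('n::finite \<Rightarrow> 'k::field_char_0 \<Rightarrow> complex) \<Rightarrow> 'k set \<Rightarrow> 'n ot_point \<Rightarrow> 'n ot_vector set" where
  "ot_tangent \<sigma> U p = {ot_dproj \<sigma> U z v | z v. z \<in> p}"

text \<open>The complex structure on the tangent spaces of \<open>M\<close>.\<close>

definition ot_J :: "'n::finite ot_vector \<Rightarrow> 'n ot_vector" where
  "ot_J X = (\<lambda>(z, v). (z, \<i> *s v)) ` X"

definition ot_pull0 ::
  "('n::finite \<Rightarrow> 'k::field_char_0 \<Rightarrow> complex) \<Rightarrow> 'k set \<Rightarrow> 'n ot_form0 \<Rightarrow> 'n form0" where
  "ot_pull0 \<sigma> U f z = f (ot_proj \<sigma> U z)"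

definition ot_pull1 ::
  "('n::finite \<Rightarrow> 'k::field_char_0 \<Rightarrow> complex) \<Rightarrow> 'k set \<Rightarrow> 'n ot_form1 \<Rightarrow> 'n form1" where
  "ot_pull1 \<sigma> U \<alpha> z v = \<alpha> (ot_proj \<sigma> U z) (ot_dproj \<sigma> U z v)"

definition ot_pull2 ::
  "('n::finite \<Rightarrow> 'k::field_char_0 \<Rightarrow> complex) \<Rightarrow> 'k set \<Rightarrow> 'n ot_form2 \<Rightarrow> 'n form2" where
  "ot_pull2 \<sigma> U \<omega> z v w = \<omega> (ot_proj \<sigma> U z) (ot_dproj \<sigma> U z v) (ot_dproj \<sigma> U z w)"

text \<open>
  A form on \<open>HC\<close> invariant under the group descends to the form on \<open>M\<close> whose pullback it is:
  evaluate on arbitrary representatives over a common base point. (Only used on invariant forms.)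
\<close>

definition ot_descend1 :: "'n::finite form1 \<Rightarrow> 'n ot_form1" where
  "ot_descend1 \<beta> p X = (THE c. \<exists>z\<in>p. \<exists>v. (z, v) \<in> X \<and> c = \<beta> z v)"

definition ot_descend2 :: "'n::finite form2 \<Rightarrow> 'n ot_form2" where
  "ot_descend2 \<beta> p X Y = (THE c. \<exists>z\<in>p. \<exists>v w. (z, v) \<in> X \<and> (z, w) \<in> Y \<and> c = \<beta> z v w)"

text \<open>The covering map is a local diffeomorphism, so smoothness and the exterior derivative on \<open>M\<close>
  are computed upstairs.\<close>

definition ot_smooth ::
  "('s::finite + 't::finite \<Rightarrow> 'k::field_char_0 \<Rightarrow> complex) \<Rightarrow> 'k set \<Rightarrow> ('s + 't) ot_form0 \<Rightarrow> bool" where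
  "ot_smooth \<sigma> U f \<longleftrightarrow> smooth_on HC (ot_pull0 \<sigma> U f)"

definition ot_smooth_form2 ::
  "('s::finite + 't::finite \<Rightarrow> 'k::field_char_0 \<Rightarrow> complex) \<Rightarrow> 'k set \<Rightarrow> ('s + 't) ot_form2 \<Rightarrow> bool" where
  "ot_smooth_form2 \<sigma> U \<omega> \<longleftrightarrow>
     (\<forall>z\<in>HC. bilinear (ot_pull2 \<sigma> U \<omega> z) \<and> (\<forall>v. ot_pull2 \<sigma> U \<omega> z v v = 0)) \<and>
     (\<forall>v w. smooth_on HC (\<lambda>z. ot_pull2 \<sigma> U \<omega> z v w))"

definition ot_d0 ::
  "('n::finite \<Rightarrow> 'k::field_char_0 \<Rightarrow> complex) \<Rightarrow> 'k set \<Rightarrow> 'n ot_form0 \<Rightarrow> 'n ot_form1" where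
  "ot_d0 \<sigma> U f = ot_descend1 (extd0 (ot_pull0 \<sigma> U f))"

definition ot_d1 ::
  "('n::finite \<Rightarrow> 'k::field_char_0 \<Rightarrow> complex) \<Rightarrow> 'k set \<Rightarrow> 'n ot_form1 \<Rightarrow> 'n ot_form2" where
  "ot_d1 \<sigma> U \<alpha> = ot_descend2 (extd1 (ot_pull1 \<sigma> U \<alpha>))"

definition ot_wedge :: "'n::finite ot_form1 \<Rightarrow> 'n ot_form1 \<Rightarrow> 'n ot_form2" where
  "ot_wedge \<alpha> \<beta> p X Y = \<alpha> p X * \<beta> p Y - \<alpha> p Y * \<beta> p X"

text \<open>The complex structure acting on 1-forms by \<open>(I\<alpha>)(X) = \<alpha>(JX)\<close>, that is, by \<open>\<i>\<close> on
  \<open>(1,0)\<close>-forms and by \<open>-\<i>\<close> on \<open>(0,1)\<close>-forms. See \<open>weight_nabla_01\<close> below for why this is the sign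
  compatible with the holomorphic structure of the weight bundle.\<close>

definition ot_I :: "'n::finite ot_form1 \<Rightarrow> 'n ot_form1" where
  "ot_I \<alpha> p X = \<alpha> p (ot_J X)"

definition ot_part01 :: "'n::finite ot_form1 \<Rightarrow> 'n ot_form1" where
  "ot_part01 \<alpha> p X = (\<alpha> p X + \<i> * \<alpha> p (ot_J X)) / 2"

text \<open>Semi-positive means: a real \<open>(1,1)\<close>-form \<open>\<omega>\<close> with \<open>\<omega>(X, JX) \<ge> 0\<close>. With the above wedge
  product \<open>\<i> dz \<and> dzbar\<close> is semi-positive.\<close>

definition ot_semi_positive ::
  "('s::finite + 't::finite \<Rightarrow> 'k::field_char_0 \<Rightarrow> complex) \<Rightarrow> 'k set \<Rightarrow> ('s + 't) ot_form2 \<Rightarrow> bool" where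
  "ot_semi_positive \<sigma> U \<omega> \<longleftrightarrow>
     (\<forall>p\<in>ot_manifold \<sigma> U. \<forall>X\<in>ot_tangent \<sigma> U p. \<forall>Y\<in>ot_tangent \<sigma> U p.
        \<omega> p X Y \<in> \<real> \<and> \<omega> p (ot_J X) (ot_J Y) = \<omega> p X Y \<and> Re (\<omega> p X (ot_J X)) \<ge> 0)"


section \<open>The Lee form and the weight bundle\<close>

definition lee_cover :: "('s::finite + 't::finite) form1" where
  "lee_cover z v = - extd0 (\<lambda>x. of_real (ln (\<Prod>i\<in>UNIV. Im (x $ Inl i)))) z v"

definition lee_form :: "('s::finite + 't::finite) ot_form1" where
  "lee_form = ot_descend1 lee_cover"

definition lee_form_c :: "('s::finite + 't::finite) ot_form1" where
  "lee_form_c = ot_I lee_form"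

text \<open>
  The weight bundle is the trivial Hermitian line bundle, so its sections are functions on \<open>M\<close> and
  its bundle-valued forms are forms on \<open>M\<close>. The connection \<open>\<nabla> = \<nabla>\<^sub>0 + \<i>\<theta>\<^sup>c\<close> acts on
  sections by \<open>f \<mapsto> df + f \<i>\<theta>\<^sup>c\<close> and on bundle-valued 1-forms by \<open>\<alpha> \<mapsto> d\<alpha> + \<i>\<theta>\<^sup>c \<and> \<alpha>\<close>.
\<close>

definition weight_nabla0 ::
  "('s::finite + 't::finite \<Rightarrow> 'k::field_char_0 \<Rightarrow> complex) \<Rightarrow> 'k set \<Rightarrow>
     ('s + 't) ot_form0 \<Rightarrow> ('s + 't) ot_form1" where
  "weight_nabla0 \<sigma> U f p X = ot_d0 \<sigma> U f p X + f p * (\<i> * lee_form_c p X)"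

definition weight_nabla1 ::
  "('s::finite + 't::finite \<Rightarrow> 'k::field_char_0 \<Rightarrow> complex) \<Rightarrow> 'k set \<Rightarrow>
     ('s + 't) ot_form1 \<Rightarrow> ('s + 't) ot_form2" where
  "weight_nabla1 \<sigma> U \<alpha> p X Y =
     ot_d1 \<sigma> U \<alpha> p X Y + ot_wedge (\<lambda>q Z. \<i> * lee_form_c q Z) \<alpha> p X Y"

definition weight_nabla_sq ::
  "('s::finite + 't::finite \<Rightarrow> 'k::field_char_0 \<Rightarrow> complex) \<Rightarrow> 'k set \<Rightarrow>
     ('s + 't) ot_form0 \<Rightarrow> ('s + 't) ot_form2" where
  "weight_nabla_sq \<sigma> U f = weight_nabla1 \<sigma> U (weight_nabla0 \<sigma> U f)"

text \<open>The holomorphic structure \<open>\<partial>bar + \<theta>\<^sup>0\<^sup>,\<^sup>1\<close> of the weight bundle.\<close>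

definition weight_dbar ::
  "('s::finite + 't::finite \<Rightarrow> 'k::field_char_0 \<Rightarrow> complex) \<Rightarrow> 'k set \<Rightarrow>
     ('s + 't) ot_form0 \<Rightarrow> ('s + 't) ot_form1" where
  "weight_dbar \<sigma> U f p X = ot_part01 (ot_d0 \<sigma> U f) p X + f p * ot_part01 lee_form p X"

text \<open>
  \<open>\<nabla>\<^sup>2\<close> is an operator on sections. A 2-form \<open>\<omega>\<close> is the form \<open>\<i>\<nabla>\<^sup>2\<close> if multiplication
  by \<open>\<omega>\<close> is \<open>\<i>\<nabla>\<^sup>2\<close> on all smooth sections; such \<open>\<omega>\<close> is unique on \<open>M\<close>, as the section 1 shows.
\<close>

definition is_i_nabla_sq ::
  "('s::finite + 't::finite \<Rightarrow> 'k::field_char_0 \<Rightarrow> complex) \<Rightarrow> 'k set \<Rightarrow> ('s + 't) ot_form2 \<Rightarrow> bool" where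
  "is_i_nabla_sq \<sigma> U \<omega> \<longleftrightarrow> ot_smooth_form2 \<sigma> U \<omega> \<and>
     (\<forall>f. ot_smooth \<sigma> U f \<longrightarrow> (\<forall>p\<in>ot_manifold \<sigma> U. \<forall>X\<in>ot_tangent \<sigma> U p. \<forall>Y\<in>ot_tangent \<sigma> U p.
        \<i> * weight_nabla_sq \<sigma> U f p X Y = \<omega> p X Y * f p))"

definition omega0 ::
  "('s::finite + 't::finite \<Rightarrow> 'k::field_char_0 \<Rightarrow> complex) \<Rightarrow> 'k set \<Rightarrow> ('s + 't) ot_form2" where
  "omega0 \<sigma> U p X Y = \<i> * weight_nabla_sq \<sigma> U (\<lambda>_. 1) p X Y"

text \<open>
  With \<open>\<theta> = d log \<phi>\<close> one has \<open>\<i>\<theta>\<^sup>c = (\<partial>bar - \<partial>) log \<phi>\<close>, hence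
  \<open>\<i>\<nabla>\<^sup>2 = 2\<i> \<partial>\<partial>bar log \<phi>\<close>; and \<open>\<partial>\<partial>bar (- log Im z) = dz \<and> dzbar / (4 (Im z)\<^sup>2)\<close>.
  This is where the factors \<open>2\<close> and \<open>1/2\<close> in the formulas for \<open>omega0\<close> come from.
\<close>

definition phi :: "complex^('s::finite + 't::finite) \<Rightarrow> real" where
  "phi z = (\<Prod>i\<in>UNIV. inverse (Im (z $ Inl i)))"


subsection \<open>The Lee form descends, and the connection induces the holomorphic structure\<close>

lemma embedding_Inl:
  assumes "all_embeddings \<sigma>"
  shows "field_embedding (\<sigma> (Inl i))" "\<sigma> (Inl i) x = of_real (Re (\<sigma> (Inl i) x))"
proof -
  have "\<sigma> (Inl i) \<in> {f. field_embedding f \<and> range f \<subseteq> \<real>}"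
    using assms unfolding all_embeddings_def bij_betw_def by blast
  then show "field_embedding (\<sigma> (Inl i))" "\<sigma> (Inl i) x = of_real (Re (\<sigma> (Inl i) x))"
    by (auto simp: image_subset_iff)
qed

lemma embedding_zero_one:
  assumes "field_embedding f"
  shows "f 0 = 0" "f 1 = 1"
proof -
  have "f (0 + 0) = f 0 + f 0" using assms unfolding field_embedding_def by blast
  then show "f 0 = 0" by simp
  show "f 1 = 1" using assms unfolding field_embedding_def by blast
qed

lemma lee_cover_eq:
  assumes "z \<in> HC"
  shows "lee_cover z v = - (\<Sum>i\<in>UNIV. of_real (Im (v $ Inl i) / Im (z $ Inl i)))"
proof -
  let ?g = "\<lambda>x :: complex^('a + 'b). complex_of_real (\<Sum>i\<in>UNIV. ln (Im (x $ Inl i)))"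
  have pos: "\<And>i. Im (z $ Inl i) > 0" using assms by (auto simp: HC_def)
  have op: "open (HC :: (complex^('a + 'b)) set)"
  proof -
    have "HC = (\<Inter>i\<in>UNIV. {z :: complex^('a + 'b). 0 < Im (z $ Inl i)})"
      by (auto simp: HC_def)
    also have "open \<dots>"
      by (intro open_INT ballI open_Collect_less continuous_intros) auto
    finally show ?thesis .
  qed
  have "(?g has_derivative (\<lambda>h. of_real (\<Sum>i\<in>UNIV. Im (h $ Inl i) / Im (z $ Inl i)))) (at z)"
    using pos by (auto intro!: derivative_eq_intros bounded_linear_imp_has_derivative
        bounded_linear_vec_nth simp: less_imp_neq[symmetric] divide_inverse)
  then have D: "((\<lambda>x. of_real (ln (\<Prod>i\<in>UNIV. Im (x $ Inl i)))) has_derivative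
      (\<lambda>h. of_real (\<Sum>i\<in>UNIV. Im (h $ Inl i) / Im (z $ Inl i)) :: complex)) (at z)"
    by (rule has_derivative_transform_within_open[OF _ op assms])
       (auto simp: HC_def ln_prod less_imp_neq[symmetric])
  show ?thesis
    unfolding lee_cover_def extd0_def frechet_derivative_at[OF D, symmetric] by simp
qed

lemma lee_cover_invariant:
  assumes "all_embeddings \<sigma>" "admissible \<sigma> U" "g \<in> ot_group U" "z \<in> HC"
  shows "ot_act \<sigma> g z \<in> HC" "lee_cover (ot_act \<sigma> g z) (ot_dact \<sigma> g v) = lee_cover z v"
proof -
  obtain a u where g: "g = (a, u)" "u \<in> U" using assms(3) by (auto simp: ot_group_def)
  have pos: "Re (\<sigma> (Inl i) u) > 0" for i
    using assms(2) g by (auto simp: admissible_def positive_units_def)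
  have real: "Im (\<sigma> (Inl i) x) = 0" for i x
    by (metis embedding_Inl(2)[OF assms(1)] Im_complex_of_real)
  show "ot_act \<sigma> g z \<in> HC"
    using assms(4) pos by (simp add: HC_def g ot_act_def transl_def rot_def real)
  then show "lee_cover (ot_act \<sigma> g z) (ot_dact \<sigma> g v) = lee_cover z v"
    using pos by (simp add: lee_cover_eq assms(4) g ot_act_def ot_dact_def transl_def rot_def real
        less_imp_neq[symmetric])
qed

lemma ot_group_one:
  assumes "admissible \<sigma> U"
  shows "(0, 1) \<in> ot_group U"
  using assms by (auto simp: ot_group_def admissible_def integers_of_def)

lemma lee_form_pullback:
  assumes "all_embeddings \<sigma>" "admissible \<sigma> U" "z \<in> HC"
  shows "ot_pull1 \<sigma> U lee_form z v = lee_cover z v"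
proof -
  have "(THE c. \<exists>x\<in>ot_proj \<sigma> U z. \<exists>w. (x, w) \<in> ot_dproj \<sigma> U z v \<and> c = lee_cover x w)
      = lee_cover z v"
  proof (rule the_equality)
    let ?g = "(0, 1) :: 'c \<times> 'c"
    have g: "?g \<in> ot_group U" by (rule ot_group_one[OF assms(2)])
    show "\<exists>x\<in>ot_proj \<sigma> U z. \<exists>w. (x, w) \<in> ot_dproj \<sigma> U z v \<and> lee_cover z v = lee_cover x w"
      using g lee_cover_invariant(2)[OF assms(1,2) g assms(3), of v]
      unfolding ot_proj_def ot_dproj_def by (metis (no_types, lifting) imageI)
  qed (auto simp: ot_dproj_def lee_cover_invariant[OF assms(1,2) _ assms(3)])
  then show ?thesis
    by (simp add: ot_pull1_def lee_form_def ot_descend1_def)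
qed

lemma ot_J_dproj: "ot_J (ot_dproj \<sigma> U z v) = ot_dproj \<sigma> U z (\<i> *s v)"
proof -
  have "\<i> *s ot_dact \<sigma> g v = ot_dact \<sigma> g (\<i> *s v)" for g
    by (simp add: ot_dact_def rot_def vec_eq_iff)
  then show ?thesis
    by (simp add: ot_J_def ot_dproj_def image_image)
qed

text \<open>\<open>\<nabla>\<close> is Hermitian for the trivial metric, as its connection form \<open>\<i>\<theta>\<^sup>c\<close> is purely
  imaginary, and its \<open>(0,1)\<close>-part is the holomorphic structure: it is the Chern connection.\<close>

lemma weight_connection_form_imaginary:
  assumes "all_embeddings \<sigma>" "admissible \<sigma> U" "z \<in> HC"
  shows "Re (\<i> * lee_form_c (ot_proj \<sigma> U z) (ot_dproj \<sigma> U z v)) = 0"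
  using lee_form_pullback[OF assms, of "\<i> *s v"]
  by (simp add: lee_form_c_def ot_I_def ot_J_dproj ot_pull1_def lee_cover_eq assms(3))

lemma weight_nabla_01:
  assumes "all_embeddings \<sigma>" "admissible \<sigma> U" "z \<in> HC"
  shows "ot_part01 (weight_nabla0 \<sigma> U f) (ot_proj \<sigma> U z) (ot_dproj \<sigma> U z v)
    = weight_dbar \<sigma> U f (ot_proj \<sigma> U z) (ot_dproj \<sigma> U z v)"
proof -
  have "lee_form (ot_proj \<sigma> U z) (ot_J (ot_J (ot_dproj \<sigma> U z v)))
      = - lee_form (ot_proj \<sigma> U z) (ot_dproj \<sigma> U z v)"
    using lee_form_pullback[OF assms, of v] lee_form_pullback[OF assms, of "\<i> *s (\<i> *s v)"]
    by (simp add: ot_J_dproj ot_pull1_def lee_cover_eq assms(3) sum_negf)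
  then show ?thesis
    by (simp add: ot_part01_def weight_nabla0_def weight_dbar_def lee_form_c_def ot_I_def
        field_simps)
qed

end

theory Submission
  imports Defs "Jordan_Normal_Form.Char_Poly"
begin

text \<open>On the cover, the Lee form is \<open>\<theta>(v) = - \<Sum>\<^sub>i Im v\<^sub>i / y\<^sub>i\<close> with \<open>y\<^sub>i = Im z\<^sub>i\<close>, so
  \<open>\<theta>\<^sup>c(v) = \<theta>(\<i>v) = - \<Sum>\<^sub>i Re v\<^sub>i / y\<^sub>i\<close>. For a section \<open>f\<close>, the square of \<open>\<nabla> = d + \<i>\<theta>\<^sup>c\<close> is
  \<open>\<nabla>\<^sup>2f = ddf + d(f \<i>\<theta>\<^sup>c) + \<i>\<theta>\<^sup>c \<and> df = f \<i> d\<theta>\<^sup>c\<close>: the term \<open>ddf\<close> vanishes because second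
  derivatives commute, the terms with \<open>df\<close> cancel, and \<open>\<theta>\<^sup>c \<and> \<theta>\<^sup>c = 0\<close>. Hence \<open>\<i>\<nabla>\<^sup>2\<close> is
  multiplication by \<open>- d\<theta>\<^sup>c\<close>, and differentiating the formula for \<open>\<theta>\<^sup>c\<close> gives
  \<open>- d\<theta>\<^sup>c(v,w) = \<Sum>\<^sub>i (Re v\<^sub>i Im w\<^sub>i - Im v\<^sub>i Re w\<^sub>i) / y\<^sub>i\<^sup>2\<close>, which is called \<open>lee_curvature\<close> below.
  At \<open>w = \<i>v\<close> it equals \<open>\<Sum>\<^sub>i |v\<^sub>i|\<^sup>2 / y\<^sub>i\<^sup>2 \<ge> 0\<close>; it is \<open>\<i>/2 \<Sum>\<^sub>i dz\<^sub>i \<and> dzbar\<^sub>i / y\<^sub>i\<^sup>2\<close>; and since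
  \<open>\<theta> = d log \<phi>\<close> is closed and \<open>\<partial>bar log \<phi> = (\<theta> + \<i>\<theta>\<^sup>c)/2\<close>, it is also \<open>2\<i> \<partial>\<partial>bar log \<phi>\<close>.\<close>

text \<open>To compute upstairs, forms on the quotient have to be evaluated on any representatives of a
  tangent vector, and three facts make this possible. Orbits are classes of a group action: this
  needs \<open>a + ub\<close> to be an algebraic integer when \<open>a\<close>, \<open>u\<close>, \<open>b\<close> are, so the algebraic integers
  have to be a ring (\<open>algebraic_int_add_mult\<close>). The exterior derivative of an invariant form is
  invariant, by the chain rule (\<open>extd1_act\<close>). Finally, two tangent vectors represented over the
  same base point are moved there by the same differential, because the action on \<open>HC\<close> is free
  (\<open>ot_dact_eq_if_ot_act_eq\<close>); so the value of a 2-form on them is determined.\<close>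

section \<open>The ring of algebraic integers\<close>

text \<open>From here on, \<open>$\<close> only denotes coordinates in \<open>complex^'n\<close>.\<close>
no_notation vec_index (infixl "$" 100)

text \<open>The determinant trick: if multiplication by \<open>x\<close> maps the \<open>\<int>\<close>-span of the \<open>w\<close>'s into itself, it is
  given by an integer matrix with eigenvector \<open>w\<close> and eigenvalue \<open>x\<close>, and the characteristic
  polynomial of that matrix is monic with integer coefficients.\<close>
lemma algebraic_int_if_stable_span:
  fixes x :: "'a::field_char_0" and w :: "'i \<Rightarrow> 'a"
  assumes I: "finite I" and nz: "\<exists>k\<in>I. w k \<noteq> 0"
    and stable: "\<And>k. k \<in> I \<Longrightarrow> \<exists>c. x * w k = (\<Sum>l\<in>I. of_int (c l) * w l)"
  shows "algebraic_int x"
proof -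
  obtain e where e: "bij_betw e {0..<card I} I"
    using ex_bij_betw_nat_finite[OF I] by blast
  let ?N = "card I"
  obtain c where c: "\<And>k. k \<in> I \<Longrightarrow> x * w k = (\<Sum>l\<in>I. of_int (c k l) * w l)"
    using stable by metis
  define B :: "int mat" where "B = mat ?N ?N (\<lambda>(k, l). c (e k) (e l))"
  define A :: "'a mat" where "A = map_mat of_int B"
  have B: "B \<in> carrier_mat ?N ?N" by (simp add: B_def)
  then have A: "A \<in> carrier_mat ?N ?N" by (simp add: A_def)
  have eI: "e k \<in> I" if "k < ?N" for k
    using e that by (auto simp: bij_betw_def)
  obtain k where k: "k < ?N" "w (e k) \<noteq> 0"
    using nz e unfolding bij_betw_def by (metis atLeastLessThan_iff imageE)
  have "eigenvector A (Matrix.vec ?N (\<lambda>k. w (e k))) x"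
    unfolding eigenvector_def
  proof (intro conjI)
    show "Matrix.vec ?N (\<lambda>k. w (e k)) \<in> carrier_vec (dim_row A)"
      using A by simp
    show "Matrix.vec ?N (\<lambda>k. w (e k)) \<noteq> 0\<^sub>v (dim_row A)"
      using k A by (metis carrier_matD(1) index_vec index_zero_vec(1))
    show "A *\<^sub>v Matrix.vec ?N (\<lambda>k. w (e k)) = x \<cdot>\<^sub>v Matrix.vec ?N (\<lambda>k. w (e k))"
    proof (rule eq_vecI)
      fix j assume "j < dim_vec (x \<cdot>\<^sub>v Matrix.vec ?N (\<lambda>k. w (e k)))"
      then have j: "j < ?N" by simp
      have "vec_index (A *\<^sub>v Matrix.vec ?N (\<lambda>k. w (e k))) j
          = (\<Sum>l\<in>{0..<?N}. of_int (c (e j) (e l)) * w (e l))"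
        using j by (simp add: A_def B_def scalar_prod_def)
      also have "\<dots> = (\<Sum>l\<in>I. of_int (c (e j) l) * w l)"
        by (rule sum.reindex_bij_betw[OF e])
      finally show "vec_index (A *\<^sub>v Matrix.vec ?N (\<lambda>k. w (e k))) j
          = vec_index (x \<cdot>\<^sub>v Matrix.vec ?N (\<lambda>k. w (e k))) j"
        using c[OF eI[OF j]] j by simp
    qed (use A in simp)
  qed
  then have "poly (char_poly A) x = 0"
    using eigenvalue_root_char_poly[OF A] unfolding eigenvalue_def by blast
  moreover have "char_poly A = map_poly of_int (char_poly B)"
    unfolding A_def by (rule of_int_hom.char_poly_hom[OF B])
  moreover have "lead_coeff (char_poly B) = 1"
    using degree_monic_char_poly[OF B] by simp
  ultimately show ?thesis
    unfolding algebraic_int_altdef_ipoly by metis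
qed

text \<open>A monic equation of degree \<open>n\<close> lets \<open>x ^ n\<close>, and then by induction every higher power, be rewritten
  in terms of \<open>1, x, ..., x ^ (n - 1)\<close>.\<close>
lemma algebraic_int_powers_span:
  fixes x :: "'a::field_char_0"
  assumes "algebraic_int x"
  obtains n where "n > 0" "\<And>a. \<exists>c. x ^ a = (\<Sum>i<n. of_int (c i) * x ^ i)"
proof -
  obtain p :: "int poly" where p: "poly (map_poly of_int p) x = 0" "lead_coeff p = 1"
    using assms unfolding algebraic_int_altdef_ipoly by blast
  define n where "n = degree p"
  have root: "(\<Sum>i<n. of_int (coeff p i) * x ^ i) + x ^ n = 0"
    using p by (simp add: poly_altdef coeff_map_poly n_def lessThan_Suc_atMost[symmetric])
  have "n > 0"
    using root by (cases "n = 0") auto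
  moreover have "\<exists>c. x ^ a = (\<Sum>i<n. of_int (c i) * x ^ i)" for a
  proof (induction a)
    case 0
    have "(\<Sum>i<n. of_int (if i = 0 then 1 else 0) * x ^ i) = (\<Sum>i<n. if i = 0 then 1 else 0)"
      by (intro sum.cong) auto
    then have "x ^ 0 = (\<Sum>i<n. of_int (if i = 0 then 1 else 0) * x ^ i)"
      using \<open>n > 0\<close> by simp
    then show ?case by (intro exI[of _ "\<lambda>i. if i = 0 then 1 else 0"])
  next
    case (Suc a)
    then obtain c where c: "x ^ a = (\<Sum>i<n. of_int (c i) * x ^ i)" by blast
    obtain m where m: "n = Suc m" using \<open>n > 0\<close> gr0_implies_Suc by blast
    \<comment> \<open>shift the coefficients by one degree and replace \<open>x ^ n\<close> by the lower powers\<close>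
    define d where "d i = (case i of 0 \<Rightarrow> 0 | Suc i \<Rightarrow> c i) - c m * coeff p i" for i
    have "x ^ Suc a = (\<Sum>i<Suc m. of_int (c i) * x ^ Suc i)"
      by (simp add: c m sum_distrib_left algebra_simps)
    also have "\<dots> = (\<Sum>i<m. of_int (c i) * x ^ Suc i) + of_int (c m) * x ^ n"
      by (simp add: m)
    also have "x ^ n = - (\<Sum>i<n. of_int (coeff p i) * x ^ i)"
      using root by (simp add: add_eq_0_iff)
    also have "(\<Sum>i<m. of_int (c i) * x ^ Suc i)
        = (\<Sum>i<n. of_int (case i of 0 \<Rightarrow> 0 | Suc i \<Rightarrow> c i) * x ^ i)"
      unfolding m sum.lessThan_Suc_shift by simp
    also have "\<dots> + of_int (c m) * - (\<Sum>i<n. of_int (coeff p i) * x ^ i)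
        = (\<Sum>i<n. of_int (d i) * x ^ i)"
      by (simp add: d_def sum_distrib_left sum_subtractf left_diff_distrib mult.assoc)
    finally show ?case by blast
  qed
  ultimately show ?thesis by (rule that)
qed

text \<open>The products \<open>x ^ i * y ^ j\<close> span a finitely generated module that is stable under
  multiplication by \<open>x\<close> and by \<open>y\<close>, hence by \<open>x + y\<close> and by \<open>x * y\<close>.\<close>
lemma algebraic_int_add_mult:
  fixes x y :: "'a::field_char_0"
  assumes "algebraic_int x" "algebraic_int y"
  shows "algebraic_int (x + y)" "algebraic_int (x * y)"
proof -
  obtain n where n: "n > 0" "\<And>a. \<exists>c. x ^ a = (\<Sum>i<n. of_int (c i) * x ^ i)"
    using algebraic_int_powers_span[OF assms(1)] by metis
  obtain m where m: "m > 0" "\<And>b. \<exists>c. y ^ b = (\<Sum>j<m. of_int (c j) * y ^ j)"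
    using algebraic_int_powers_span[OF assms(2)] by metis
  define I where "I = {..<n} \<times> {..<m}"
  define w where "w = (\<lambda>(i, j). x ^ i * y ^ j)"
  have fin: "finite I" by (simp add: I_def)
  have nz: "\<exists>k\<in>I. w k \<noteq> 0"
    using n(1) m(1) by (intro bexI[of _ "(0, 0)"]) (auto simp: I_def w_def)
  have span: "\<exists>c. x ^ a * y ^ b = (\<Sum>k\<in>I. of_int (c k) * w k)" for a b
  proof -
    obtain c d where c: "x ^ a = (\<Sum>i<n. of_int (c i) * x ^ i)"
      and d: "y ^ b = (\<Sum>j<m. of_int (d j) * y ^ j)"
      using n(2) m(2) by metis
    have "x ^ a * y ^ b = (\<Sum>(i, j)\<in>I. of_int (c i) * x ^ i * (of_int (d j) * y ^ j))"
      unfolding c d sum_product I_def sum.cartesian_product ..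
    also have "\<dots> = (\<Sum>k\<in>I. of_int (c (fst k) * d (snd k)) * w k)"
      by (intro sum.cong) (auto simp: w_def)
    finally show ?thesis by (intro exI[of _ "\<lambda>k. c (fst k) * d (snd k)"])
  qed
  show "algebraic_int (x + y)"
  proof (rule algebraic_int_if_stable_span[OF fin nz])
    fix k assume "k \<in> I"
    obtain i j where k: "k = (i, j)" by force
    obtain c d where c: "x ^ Suc i * y ^ j = (\<Sum>k\<in>I. of_int (c k) * w k)"
      and d: "x ^ i * y ^ Suc j = (\<Sum>k\<in>I. of_int (d k) * w k)"
      using span by metis
    have "(x + y) * w k = x ^ Suc i * y ^ j + x ^ i * y ^ Suc j"
      by (simp add: k w_def algebra_simps)
    also have "\<dots> = (\<Sum>k\<in>I. of_int (c k + d k) * w k)"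
      unfolding c d by (simp add: sum.distrib distrib_right)
    finally show "\<exists>c. (x + y) * w k = (\<Sum>l\<in>I. of_int (c l) * w l)"
      by (intro exI[of _ "\<lambda>k. c k + d k"])
  qed
  show "algebraic_int (x * y)"
  proof (rule algebraic_int_if_stable_span[OF fin nz])
    fix k assume "k \<in> I"
    obtain i j where k: "k = (i, j)" by force
    have "x * y * w k = x ^ Suc i * y ^ Suc j"
      by (simp add: k w_def)
    then show "\<exists>c. x * y * w k = (\<Sum>l\<in>I. of_int (c l) * w l)"
      using span[of "Suc i" "Suc j"] by (simp only:)
  qed
qed


section \<open>Symmetry of second derivatives and smooth functions\<close>

text \<open>Applying the mean value theorem first along \<open>v\<close> and then along \<open>w\<close> turns the second difference
  of \<open>f\<close> into a second derivative. The second difference is symmetric in \<open>v\<close> and \<open>w\<close>, which is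
  what makes the mixed derivatives equal.\<close>
lemma second_difference_mean_value:
  fixes f :: "'a::real_normed_vector \<Rightarrow> real"
  assumes t: "t > 0"
    and inS: "\<And>a b. 0 \<le> a \<Longrightarrow> a \<le> t \<Longrightarrow> 0 \<le> b \<Longrightarrow> b \<le> t \<Longrightarrow> z + a *\<^sub>R v + b *\<^sub>R w \<in> S"
    and f': "\<And>x. x \<in> S \<Longrightarrow> (f has_derivative f' x) (at x)"
    and f'': "\<And>x. x \<in> S \<Longrightarrow> ((\<lambda>y. f' y v) has_derivative A x) (at x)"
  obtains a b where "0 \<le> a" "a \<le> t" "0 \<le> b" "b \<le> t"
    "f (z + t *\<^sub>R v + t *\<^sub>R w) - f (z + t *\<^sub>R v) - f (z + t *\<^sub>R w) + f z
      = t\<^sup>2 * A (z + a *\<^sub>R v + b *\<^sub>R w) w"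
proof -
  define g where "g a = f (z + a *\<^sub>R v + t *\<^sub>R w) - f (z + a *\<^sub>R v)" for a
  have lin: "f' x (h *\<^sub>R u) = h * f' x u" "A x (h *\<^sub>R u) = h * A x u" if "x \<in> S" for x h u
    using linear_cmul[OF has_derivative_linear[OF f'[OF that]], of h u]
      linear_cmul[OF has_derivative_linear[OF f''[OF that]], of h u] by simp_all
  have g': "(g has_real_derivative f' (z + a *\<^sub>R v + t *\<^sub>R w) v - f' (z + a *\<^sub>R v) v) (at a)"
    if a: "0 \<le> a" "a \<le> t" for a
  proof -
    have S: "z + a *\<^sub>R v + t *\<^sub>R w \<in> S" "z + a *\<^sub>R v \<in> S"
      using inS[of a t] inS[of a 0] a t by auto
    have "((\<lambda>a. z + a *\<^sub>R v + t *\<^sub>R w) has_derivative (\<lambda>h. h *\<^sub>R v)) (at a)"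
      "((\<lambda>a. z + a *\<^sub>R v) has_derivative (\<lambda>h. h *\<^sub>R v)) (at a)"
      by (auto intro!: derivative_eq_intros)
    note d = has_derivative_compose[OF this(1) f'[OF S(1)]]
      has_derivative_compose[OF this(2) f'[OF S(2)]]
    show ?thesis
      unfolding g_def has_field_derivative_def
      by (rule has_derivative_eq_rhs[OF has_derivative_diff[OF d]])
        (simp add: lin[OF S(1)] lin[OF S(2)] fun_eq_iff right_diff_distrib mult.commute)
  qed
  obtain a where a: "0 < a" "a < t"
    and ga: "g t - g 0 = t * (f' (z + a *\<^sub>R v + t *\<^sub>R w) v - f' (z + a *\<^sub>R v) v)"
    using MVT2[OF t g'] by auto
  define k where "k b = f' (z + a *\<^sub>R v + b *\<^sub>R w) v" for b
  have k': "(k has_real_derivative A (z + a *\<^sub>R v + b *\<^sub>R w) w) (at b)"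
    if b: "0 \<le> b" "b \<le> t" for b
  proof -
    have S: "z + a *\<^sub>R v + b *\<^sub>R w \<in> S"
      using inS[of a b] a b by auto
    have "((\<lambda>b. z + a *\<^sub>R v + b *\<^sub>R w) has_derivative (\<lambda>h. h *\<^sub>R w)) (at b)"
      by (auto intro!: derivative_eq_intros)
    from has_derivative_compose[OF this f''[OF S]]
    show ?thesis
      unfolding k_def has_field_derivative_def by (simp add: lin[OF S] mult_commute_abs)
  qed
  obtain b where b: "0 < b" "b < t" and kb: "k t - k 0 = t * A (z + a *\<^sub>R v + b *\<^sub>R w) w"
    using MVT2[OF t k'] by auto
  show ?thesis
  proof (rule that[of a b])
    show "f (z + t *\<^sub>R v + t *\<^sub>R w) - f (z + t *\<^sub>R v) - f (z + t *\<^sub>R w) + f z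
      = t\<^sup>2 * A (z + a *\<^sub>R v + b *\<^sub>R w) w"
      using ga kb by (simp add: g_def k_def power2_eq_square algebra_simps)
  qed (use a b in auto)
qed

text \<open>Both mixed derivatives, taken at suitable points near \<open>z\<close>, equal the same second difference
  quotient; by continuity they cannot differ at \<open>z\<close>.\<close>
lemma mixed_derivatives_commute_real:
  fixes f :: "'a::real_normed_vector \<Rightarrow> real"
  assumes "open S" "z \<in> S"
    and f': "\<And>x. x \<in> S \<Longrightarrow> (f has_derivative f' x) (at x)"
    and A: "\<And>x. x \<in> S \<Longrightarrow> ((\<lambda>y. f' y v) has_derivative A x) (at x)"
    and B: "\<And>x. x \<in> S \<Longrightarrow> ((\<lambda>y. f' y w) has_derivative B x) (at x)"
    and contA: "continuous_on S (\<lambda>x. A x w)" and contB: "continuous_on S (\<lambda>x. B x v)"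
  shows "A z w = B z v"
proof (rule ccontr)
  assume "A z w \<noteq> B z v"
  define \<epsilon> where "\<epsilon> = \<bar>A z w - B z v\<bar> / 2"
  have \<epsilon>: "\<epsilon> > 0" using \<open>A z w \<noteq> B z v\<close> by (simp add: \<epsilon>_def)
  have "isCont (\<lambda>x. A x w) z" "isCont (\<lambda>x. B x v) z"
    using contA contB assms(1,2) continuous_on_eq_continuous_at by blast+
  then obtain d1 d2 where d: "d1 > 0" "d2 > 0"
    "\<And>x. dist x z < d1 \<Longrightarrow> \<bar>A x w - A z w\<bar> < \<epsilon>" "\<And>x. dist x z < d2 \<Longrightarrow> \<bar>B x v - B z v\<bar> < \<epsilon>"
    using \<epsilon> unfolding continuous_at_eps_delta dist_real_def by metis
  obtain d3 where d3: "d3 > 0" "ball z d3 \<subseteq> S"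
    using assms(1,2) openE by blast
  define d where "d = min d1 (min d2 d3)"
  have "d > 0" using d d3 by (simp add: d_def)
  \<comment> \<open>so small that the parallelogram spanned by \<open>t *\<^sub>R v\<close> and \<open>t *\<^sub>R w\<close> at \<open>z\<close> stays in the ball of radius \<open>d\<close>\<close>
  define t where "t = d / (norm v + norm w + 1)"
  have pos: "norm v + norm w + 1 > 0" by (simp add: add_nonneg_pos)
  then have "t * (norm v + norm w + 1) = d" by (simp add: t_def)
  moreover have "t > 0" using pos \<open>d > 0\<close> by (simp add: t_def)
  ultimately have t: "t > 0" "t * (norm v + norm w) < d" by (simp_all add: distrib_left)
  have near: "dist (z + a *\<^sub>R v + b *\<^sub>R w) z < d"
    if "0 \<le> a" "a \<le> t" "0 \<le> b" "b \<le> t" for a b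
  proof -
    have "dist (z + a *\<^sub>R v + b *\<^sub>R w) z \<le> a * norm v + b * norm w"
      using norm_triangle_ineq[of "a *\<^sub>R v" "b *\<^sub>R w"] that by (simp add: dist_norm add.assoc)
    also have "\<dots> \<le> t * norm v + t * norm w"
      using that by (intro add_mono mult_right_mono) auto
    finally show ?thesis using t(2) by (simp add: distrib_left)
  qed
  have inS: "z + a *\<^sub>R v + b *\<^sub>R w \<in> S" if "0 \<le> a" "a \<le> t" "0 \<le> b" "b \<le> t" for a b
    using near[OF that] d3(2) by (auto simp: d_def dist_commute)
  obtain a b where ab: "0 \<le> a" "a \<le> t" "0 \<le> b" "b \<le> t"
    and 1: "f (z + t *\<^sub>R v + t *\<^sub>R w) - f (z + t *\<^sub>R v) - f (z + t *\<^sub>R w) + f z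
      = t\<^sup>2 * A (z + a *\<^sub>R v + b *\<^sub>R w) w"
    by (rule second_difference_mean_value[of t z v w S f f' A]) (use t(1) inS f' A in blast)+
  have inS': "z + a *\<^sub>R w + b *\<^sub>R v \<in> S" if "0 \<le> a" "a \<le> t" "0 \<le> b" "b \<le> t" for a b
    using inS[of b a] that by (simp add: add_ac)
  obtain b' a' where ab': "0 \<le> a'" "a' \<le> t" "0 \<le> b'" "b' \<le> t"
    and 2: "f (z + t *\<^sub>R w + t *\<^sub>R v) - f (z + t *\<^sub>R w) - f (z + t *\<^sub>R v) + f z
      = t\<^sup>2 * B (z + b' *\<^sub>R w + a' *\<^sub>R v) v"
    by (rule second_difference_mean_value[of t z w v S f f' B]) (use t(1) inS' f' B in blast)+
  have "t\<^sup>2 * A (z + a *\<^sub>R v + b *\<^sub>R w) w = t\<^sup>2 * B (z + a' *\<^sub>R v + b' *\<^sub>R w) v"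
    using 1 2 by (simp add: algebra_simps)
  then have "A (z + a *\<^sub>R v + b *\<^sub>R w) w = B (z + a' *\<^sub>R v + b' *\<^sub>R w) v"
    using t(1) by simp
  moreover have "\<bar>A (z + a *\<^sub>R v + b *\<^sub>R w) w - A z w\<bar> < \<epsilon>"
    "\<bar>B (z + a' *\<^sub>R v + b' *\<^sub>R w) v - B z v\<bar> < \<epsilon>"
    using near[OF ab] near[OF ab'] d(3,4) by (auto simp: d_def)
  ultimately show False
    unfolding \<epsilon>_def by (auto simp: abs_if field_simps split: if_splits)
qed

lemma mixed_derivatives_commute:
  fixes f :: "'a::real_normed_vector \<Rightarrow> 'b::euclidean_space"
  assumes "open S" "z \<in> S"
    and f': "\<And>x. x \<in> S \<Longrightarrow> (f has_derivative f' x) (at x)"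
    and A: "\<And>x. x \<in> S \<Longrightarrow> ((\<lambda>y. f' y v) has_derivative A x) (at x)"
    and B: "\<And>x. x \<in> S \<Longrightarrow> ((\<lambda>y. f' y w) has_derivative B x) (at x)"
    and contA: "continuous_on S (\<lambda>x. A x w)" and contB: "continuous_on S (\<lambda>x. B x v)"
  shows "A z w = B z v"
proof (rule euclidean_eqI)
  fix i :: 'b
  show "A z w \<bullet> i = B z v \<bullet> i"
    by (rule mixed_derivatives_commute_real[where f = "\<lambda>x. f x \<bullet> i" and f' = "\<lambda>x h. f' x h \<bullet> i"
          and A = "\<lambda>x h. A x h \<bullet> i" and B = "\<lambda>x h. B x h \<bullet> i" and S = S])
      (auto intro!: assms has_derivative_inner_left continuous_on_inner continuous_on_const)
qed

text \<open>On an open set, the derivatives that \<open>Ck_on\<close> refers to only depend on the values there.\<close>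
lemma Ck_on_cong:
  assumes "open D" "\<And>x. x \<in> D \<Longrightarrow> f x = g x" "Ck_on k D f"
  shows "Ck_on k D g"
  using assms(2,3)
proof (induction k arbitrary: f g)
  case 0
  then show ?case by (auto cong: continuous_on_cong)
next
  case (Suc k)
  have D: "(g has_derivative frechet_derivative f (at x)) (at x)" if "x \<in> D" for x
  proof (rule has_derivative_transform_within_open[OF _ assms(1) that])
    show "(f has_derivative frechet_derivative f (at x)) (at x)"
      using Suc.prems(2) that by (simp add: frechet_derivative_works)
  qed (rule Suc.prems(1))
  have eq: "frechet_derivative f (at x) = frechet_derivative g (at x)" if "x \<in> D" for x
    using frechet_derivative_at[OF D[OF that]] .
  have "Ck_on k D (\<lambda>x. frechet_derivative g (at x) v)" for v
  proof (rule Suc.IH)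
    show "frechet_derivative f (at x) v = frechet_derivative g (at x) v" if "x \<in> D" for x
      by (simp add: eq[OF that])
    show "Ck_on k D (\<lambda>x. frechet_derivative f (at x) v)"
      using Suc.prems(2) by simp
  qed
  then show ?case
    using D by (simp add: differentiable_def) blast
qed

lemma smooth_on_cong:
  assumes "open D" "\<And>x. x \<in> D \<Longrightarrow> f x = g x"
  shows "smooth_on D f \<longleftrightarrow> smooth_on D g"
  using Ck_on_cong[OF assms(1)] assms(2) unfolding smooth_on_def by metis

lemma Ck_on_const: "Ck_on k D (\<lambda>_. c)"
  by (induction k arbitrary: c) (auto simp: frechet_derivative_const)

lemma smooth_onD:
  assumes "smooth_on D f"
  shows "\<And>x. x \<in> D \<Longrightarrow> (f has_derivative frechet_derivative f (at x)) (at x)"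
    and "\<And>v. smooth_on D (\<lambda>x. frechet_derivative f (at x) v)"
    and "continuous_on D f"
proof -
  have 1: "Ck_on (Suc k) D f" for k
    using assms unfolding smooth_on_def by blast
  show "(f has_derivative frechet_derivative f (at x)) (at x)" if "x \<in> D" for x
    using 1[of 0] that by (simp add: frechet_derivative_works)
  show "smooth_on D (\<lambda>x. frechet_derivative f (at x) v)" for v
    using 1 by (auto simp: smooth_on_def)
  have "Ck_on 0 D f"
    using assms unfolding smooth_on_def by blast
  then show "continuous_on D f" by simp
qed

text \<open>The identity \<open>ddf = 0\<close> is the symmetry of second derivatives.\<close>
lemma extd1_extd0:
  assumes "open D" "smooth_on D f" "z \<in> D"
  shows "extd1 (extd0 f) z v w = 0"
proof -
  note s = smooth_onD[OF assms(2)]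
  note t = smooth_onD[OF s(2)]
  have "frechet_derivative (\<lambda>x. extd0 f x w) (at z) v = frechet_derivative (\<lambda>x. extd0 f x v) (at z) w"
    unfolding extd0_def
    by (rule mixed_derivatives_commute[OF assms(1,3) s(1) t(1) t(1) smooth_onD(3)[OF t(2)]
          smooth_onD(3)[OF t(2)]]) 
  then show ?thesis by (simp add: extd1_def)
qed

section \<open>The group action\<close>

lemma embedding_field_embedding:
  fixes \<sigma> :: "'s::finite + 't::finite \<Rightarrow> 'k::field \<Rightarrow> complex"
  assumes "all_embeddings \<sigma>"
  shows "field_embedding (\<sigma> i)"
proof (cases i)
  case (Inl j)
  then show ?thesis using embedding_Inl(1)[OF assms] by simp
next
  case (Inr j)
  have "case_sum (\<lambda>j. \<sigma> (Inr j)) (\<lambda>j. cnj \<circ> \<sigma> (Inr j)) (Inl j :: 't + 't)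
      \<in> {f. field_embedding f \<and> \<not> range f \<subseteq> \<real>}"
    using assms unfolding all_embeddings_def bij_betw_def by blast
  with Inr show ?thesis by simp
qed

lemma field_embedding_inj:
  assumes "field_embedding f" "f x = f y"
  shows "x = y"
proof (rule ccontr)
  assume "x \<noteq> y"
  have *: "f (a + b) = f a + f b" "f (a * b) = f a * f b" for a b
    using assms(1) unfolding field_embedding_def by blast+
  have "f (x - y) = 0"
    using *(1)[of "x - y" y] assms(2) by simp
  moreover have "f (x - y) * f (inverse (x - y)) = 1"
    using *(2)[of "x - y" "inverse (x - y)"] \<open>x \<noteq> y\<close> embedding_zero_one(2)[OF assms(1)] by simp
  ultimately show False by simp
qed

lemma open_HC: "open (HC :: (complex^('s::finite + 't::finite)) set)"
proof -
  have "HC = (\<Inter>i\<in>UNIV. {z :: complex^('s + 't). 0 < Im (z $ Inl i)})"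
    by (auto simp: HC_def)
  also have "open \<dots>"
    by (intro open_INT ballI open_Collect_less continuous_intros) auto
  finally show ?thesis .
qed

lemma ot_dact_linear: "linear (ot_dact \<sigma> g)"
  by (rule linearI) (simp_all add: ot_dact_def rot_def Finite_Cartesian_Product.vec_eq_iff algebra_simps)

text \<open>The action is affine, so its derivative is its linear part at every point.\<close>
lemma ot_act_has_derivative: "(ot_act \<sigma> g has_derivative ot_dact \<sigma> g) (at z)"
proof -
  have "ot_act \<sigma> g = (\<lambda>z. ot_dact \<sigma> g z + (\<chi> i. \<sigma> i (fst g)))"
    by (simp add: fun_eq_iff ot_act_def ot_dact_def transl_def rot_def Finite_Cartesian_Product.vec_eq_iff)
  moreover have "(ot_dact \<sigma> g has_derivative ot_dact \<sigma> g) (at z)"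
    using ot_dact_linear[of \<sigma> g] unfolding linear_conv_bounded_linear
    by (rule bounded_linear_imp_has_derivative)
  ultimately show ?thesis
    by (auto intro!: derivative_eq_intros)
qed

context
  fixes \<sigma> :: "'s::finite + 't::finite \<Rightarrow> 'k::field_char_0 \<Rightarrow> complex" and U :: "'k set"
  assumes emb: "all_embeddings \<sigma>" and adm: "admissible \<sigma> U"
begin

lemma embedding_hom:
  "\<sigma> i (x + y) = \<sigma> i x + \<sigma> i y" "\<sigma> i (x * y) = \<sigma> i x * \<sigma> i y" "\<sigma> i 0 = 0" "\<sigma> i 1 = 1"
  "\<sigma> i (- x) = - \<sigma> i x"
proof -
  show *: "\<sigma> i (x + y) = \<sigma> i x + \<sigma> i y" "\<sigma> i (x * y) = \<sigma> i x * \<sigma> i y" "\<sigma> i 0 = 0" "\<sigma> i 1 = 1"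
    for x y
    using embedding_field_embedding[OF emb, of i] embedding_zero_one[of "\<sigma> i"]
    unfolding field_embedding_def by blast+
  show "\<sigma> i (- x) = - \<sigma> i x"
    using *(1)[of x "- x"] by (simp add: *(3) add_eq_0_iff)
qed

text \<open>The witnesses here and in the next lemma are \<open>(a,u)(b,v) = (a + ub, uv)\<close> and
  \<open>(a,u)\<^sup>-\<^sup>1 = (- u\<^sup>-\<^sup>1a, u\<^sup>-\<^sup>1)\<close>; they lie in the group because the algebraic integers form a ring
  and \<open>u\<^sup>-\<^sup>1\<close> is one of them.\<close>
lemma ot_group_compose:
  assumes "g \<in> ot_group U" "h \<in> ot_group U"
  obtains k where "k \<in> ot_group U"
    "\<And>z. ot_act \<sigma> k z = ot_act \<sigma> g (ot_act \<sigma> h z)"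
    "\<And>v. ot_dact \<sigma> k v = ot_dact \<sigma> g (ot_dact \<sigma> h v)"
proof -
  obtain a u b v where gh: "g = (a, u)" "h = (b, v)" by (cases g, cases h)
  show ?thesis
  proof (rule that[of "(a + u * b, u * v)"])
    show "(a + u * b, u * v) \<in> ot_group U"
      using assms adm
      by (auto simp: gh ot_group_def admissible_def positive_units_def integers_of_def
          intro!: algebraic_int_add_mult)
  qed (simp_all add: gh ot_act_def ot_dact_def transl_def rot_def Finite_Cartesian_Product.vec_eq_iff embedding_hom
      algebra_simps)
qed

lemma ot_group_inverse:
  assumes "g \<in> ot_group U"
  obtains k where "k \<in> ot_group U"
    "\<And>z. ot_act \<sigma> k (ot_act \<sigma> g z) = z"
    "\<And>v. ot_dact \<sigma> k (ot_dact \<sigma> g v) = v" "\<And>v. ot_dact \<sigma> g (ot_dact \<sigma> k v) = v"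
proof -
  obtain a u where g: "g = (a, u)" by (cases g)
  have u: "u \<in> U" "inverse u \<in> U" "u \<noteq> 0" "algebraic_int (inverse u)" "algebraic_int a"
    using assms adm
    by (auto simp: g ot_group_def admissible_def positive_units_def integers_of_def)
  have inv: "\<sigma> i (inverse u) * (\<sigma> i u * x) = x" for i x
  proof -
    have "\<sigma> i (inverse u) * \<sigma> i u = 1"
      using u(3) by (metis embedding_hom(2,4) left_inverse)
    then show ?thesis by (simp add: mult.assoc[symmetric])
  qed
  show ?thesis
  proof (rule that[of "(- (inverse u * a), inverse u)"])
    show "(- (inverse u * a), inverse u) \<in> ot_group U"
      using u by (auto simp: ot_group_def integers_of_def intro!: algebraic_int_add_mult)
  qed (simp_all add: g ot_act_def ot_dact_def transl_def rot_def Finite_Cartesian_Product.vec_eq_iff embedding_hom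
      distrib_left inv mult.left_commute[of "\<sigma> _ u"])
qed

lemma ot_dproj_act:
  assumes "g \<in> ot_group U"
  shows "ot_dproj \<sigma> U (ot_act \<sigma> g z) (ot_dact \<sigma> g v) = ot_dproj \<sigma> U z v"
proof
  have sub: "ot_dproj \<sigma> U (ot_act \<sigma> g z) (ot_dact \<sigma> g v) \<subseteq> ot_dproj \<sigma> U z v"
    if g: "g \<in> ot_group U" for g z v
  proof
    fix x assume "x \<in> ot_dproj \<sigma> U (ot_act \<sigma> g z) (ot_dact \<sigma> g v)"
    then obtain h where h: "h \<in> ot_group U"
      "x = (ot_act \<sigma> h (ot_act \<sigma> g z), ot_dact \<sigma> h (ot_dact \<sigma> g v))"
      by (auto simp: ot_dproj_def)
    obtain k where "k \<in> ot_group U"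
      "\<And>z. ot_act \<sigma> k z = ot_act \<sigma> h (ot_act \<sigma> g z)"
      "\<And>v. ot_dact \<sigma> k v = ot_dact \<sigma> h (ot_dact \<sigma> g v)"
      using ot_group_compose[OF h(1) g] by metis
    then show "x \<in> ot_dproj \<sigma> U z v"
      unfolding ot_dproj_def h(2) by (intro image_eqI[of _ _ k]) auto
  qed
  show "ot_dproj \<sigma> U (ot_act \<sigma> g z) (ot_dact \<sigma> g v) \<subseteq> ot_dproj \<sigma> U z v"
    by (rule sub[OF assms])
  obtain k where k: "k \<in> ot_group U" "\<And>z. ot_act \<sigma> k (ot_act \<sigma> g z) = z"
    "\<And>v. ot_dact \<sigma> k (ot_dact \<sigma> g v) = v"
    using ot_group_inverse[OF assms] by metis
  show "ot_dproj \<sigma> U z v \<subseteq> ot_dproj \<sigma> U (ot_act \<sigma> g z) (ot_dact \<sigma> g v)"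
    using sub[OF k(1), of "ot_act \<sigma> g z" "ot_dact \<sigma> g v"] by (simp add: k)
qed

lemma ot_proj_act:
  assumes "g \<in> ot_group U"
  shows "ot_proj \<sigma> U (ot_act \<sigma> g z) = ot_proj \<sigma> U z"
proof -
  have "ot_proj \<sigma> U z = fst ` ot_dproj \<sigma> U z v" for z v
    by (simp add: ot_proj_def ot_dproj_def image_image)
  then show ?thesis using ot_dproj_act[OF assms] by metis
qed

text \<open>Over a point of \<open>HC\<close> the group element can be recovered, up to its translation part, from the
  imaginary part of a single upper half-plane coordinate: that is nonzero, is scaled by the real
  number \<open>\<sigma>\<^sub>i(u)\<close> and is not changed by translations; and \<open>\<sigma>\<^sub>i\<close> is injective.\<close>
lemma ot_dact_eq_if_ot_act_eq:
  assumes "z \<in> HC" "ot_act \<sigma> g z = ot_act \<sigma> h z"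
  shows "ot_dact \<sigma> g = ot_dact \<sigma> h"
proof -
  fix i :: 's
  have real: "Im (\<sigma> (Inl i) x) = 0" for x
    by (metis embedding_Inl(2)[OF emb] Im_complex_of_real)
  have "Im (ot_act \<sigma> g z $ Inl i) = Im (ot_act \<sigma> h z $ Inl i)"
    using assms(2) by simp
  then have "Re (\<sigma> (Inl i) (snd g)) = Re (\<sigma> (Inl i) (snd h))"
    using assms(1) by (auto simp: ot_act_def transl_def rot_def real HC_def dest: spec[of _ i])
  then have "\<sigma> (Inl i) (snd g) = \<sigma> (Inl i) (snd h)"
    by (simp add: complex_eq_iff real)
  then have "snd g = snd h"
    by (rule field_embedding_inj[OF embedding_field_embedding[OF emb]])
  then show ?thesis
    by (simp add: fun_eq_iff ot_dact_def)
qed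

text \<open>All tangent vectors at a point of the quotient can be represented over one chosen base point
  \<open>z\<close>: a representative over another point of the orbit is moved back by a group element.\<close>
lemma ot_tangent_proj:
  assumes "X \<in> ot_tangent \<sigma> U (ot_proj \<sigma> U z)"
  shows "\<exists>v. X = ot_dproj \<sigma> U z v"
proof -
  obtain z' v' where X: "X = ot_dproj \<sigma> U z' v'" and z': "z' \<in> ot_proj \<sigma> U z"
    using assms by (auto simp: ot_tangent_def)
  obtain g where g: "g \<in> ot_group U" "z' = ot_act \<sigma> g z"
    using z' by (auto simp: ot_proj_def)
  obtain k where "\<And>v. ot_dact \<sigma> g (ot_dact \<sigma> k v) = v"
    using ot_group_inverse[OF g(1)] by metis
  then have "X = ot_dproj \<sigma> U z (ot_dact \<sigma> k v')"
    using ot_dproj_act[OF g(1), of z "ot_dact \<sigma> k v'"] by (simp add: X g(2))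
  then show ?thesis ..
qed

lemma ot_descend1_proj:
  assumes "\<And>g. g \<in> ot_group U \<Longrightarrow> \<beta> (ot_act \<sigma> g z) (ot_dact \<sigma> g v) = \<beta> z v"
  shows "ot_descend1 \<beta> (ot_proj \<sigma> U z) (ot_dproj \<sigma> U z v) = \<beta> z v"
  unfolding ot_descend1_def
proof (rule the_equality)
  show "\<exists>x\<in>ot_proj \<sigma> U z. \<exists>w. (x, w) \<in> ot_dproj \<sigma> U z v \<and> \<beta> z v = \<beta> x w"
    using ot_group_one[OF adm] assms unfolding ot_proj_def ot_dproj_def
    by (metis (no_types, lifting) imageI)
qed (auto simp: ot_dproj_def assms)

text \<open>The representatives of the two vectors range over independent group elements \<open>g\<close> and \<open>h\<close>;
  a common base point forces them to have the same differential, so invariance under \<open>g\<close> applies.\<close>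
lemma ot_descend2_proj:
  assumes "z \<in> HC"
    and inv: "\<And>g. g \<in> ot_group U \<Longrightarrow>
      \<beta> (ot_act \<sigma> g z) (ot_dact \<sigma> g v) (ot_dact \<sigma> g w) = \<beta> z v w"
  shows "ot_descend2 \<beta> (ot_proj \<sigma> U z) (ot_dproj \<sigma> U z v) (ot_dproj \<sigma> U z w) = \<beta> z v w"
  unfolding ot_descend2_def
proof (rule the_equality)
  show "\<exists>x\<in>ot_proj \<sigma> U z. \<exists>v' w'. (x, v') \<in> ot_dproj \<sigma> U z v \<and> (x, w') \<in> ot_dproj \<sigma> U z w
      \<and> \<beta> z v w = \<beta> x v' w'"
    using ot_group_one[OF adm] inv unfolding ot_proj_def ot_dproj_def
    by (metis (no_types, lifting) imageI)
  fix c
  assume "\<exists>x\<in>ot_proj \<sigma> U z. \<exists>v' w'. (x, v') \<in> ot_dproj \<sigma> U z v \<and> (x, w') \<in> ot_dproj \<sigma> U z w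
      \<and> c = \<beta> x v' w'"
  then obtain g h where g: "g \<in> ot_group U" and eq: "ot_act \<sigma> g z = ot_act \<sigma> h z"
    and c: "c = \<beta> (ot_act \<sigma> g z) (ot_dact \<sigma> g v) (ot_dact \<sigma> h w)"
    by (auto simp: ot_dproj_def)
  show "c = \<beta> z v w"
    using inv[OF g] unfolding c ot_dact_eq_if_ot_act_eq[OF assms(1) eq] .
qed

text \<open>The chain rule for \<open>\<phi> \<circ> g = \<psi>\<close>. Allowing \<open>\<psi> \<noteq> \<phi>\<close> covers coefficients of invariant forms, where
  \<open>\<phi>\<close> is the coefficient at the vector \<open>g w\<close> and \<open>\<psi>\<close> the one at \<open>w\<close>.\<close>
lemma frechet_derivative_act:
  fixes \<phi> \<psi> :: "complex^('s + 't) \<Rightarrow> complex"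
  assumes "z \<in> HC" "\<And>x. x \<in> HC \<Longrightarrow> \<phi> (ot_act \<sigma> g x) = \<psi> x"
    and "\<phi> differentiable (at (ot_act \<sigma> g z))"
  shows "frechet_derivative \<phi> (at (ot_act \<sigma> g z)) (ot_dact \<sigma> g v) = frechet_derivative \<psi> (at z) v"
proof -
  have "((\<lambda>x. \<phi> (ot_act \<sigma> g x)) has_derivative
      (\<lambda>v. frechet_derivative \<phi> (at (ot_act \<sigma> g z)) (ot_dact \<sigma> g v))) (at z)"
    using assms(3) unfolding frechet_derivative_works
    by (rule has_derivative_compose[OF ot_act_has_derivative])
  from has_derivative_transform_within_open[OF this open_HC assms(1,2)]
  show ?thesis by (metis frechet_derivative_at)
qed

lemma extd1_act:
  assumes "g \<in> ot_group U" "z \<in> HC"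
    and "\<And>x w. x \<in> HC \<Longrightarrow> \<alpha> (ot_act \<sigma> g x) (ot_dact \<sigma> g w) = \<alpha> x w"
    and "\<And>x w. x \<in> HC \<Longrightarrow> (\<lambda>y. \<alpha> y w) differentiable (at x)"
  shows "extd1 \<alpha> (ot_act \<sigma> g z) (ot_dact \<sigma> g v) (ot_dact \<sigma> g w) = extd1 \<alpha> z v w"
proof -
  have "ot_act \<sigma> g z \<in> HC"
    using lee_cover_invariant(1)[OF emb adm assms(1,2)] .
  then have "frechet_derivative (\<lambda>y. \<alpha> y (ot_dact \<sigma> g w)) (at (ot_act \<sigma> g z)) (ot_dact \<sigma> g v)
      = frechet_derivative (\<lambda>y. \<alpha> y w) (at z) v" for v w
    using assms by (intro frechet_derivative_act) auto
  then show ?thesis unfolding extd1_def by simp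
qed

end

section \<open>The Lee form and the curvature\<close>

text \<open>The value \<open>- d\<theta>\<^sup>c(v,w)\<close> of the curvature form.\<close>
definition lee_curvature :: "complex^('s::finite + 't::finite) \<Rightarrow> complex^('s + 't) \<Rightarrow> complex^('s + 't) \<Rightarrow> real"
  where "lee_curvature z v w =
    (\<Sum>i\<in>UNIV. (Re (v $ Inl i) * Im (w $ Inl i) - Im (v $ Inl i) * Re (w $ Inl i)) / (Im (z $ Inl i))\<^sup>2)"

text \<open>The first sum is the derivative of \<open>\<theta>\<^sup>c(v)\<close> along \<open>w\<close>, the second that of \<open>\<theta>\<^sup>c(w)\<close> along \<open>v\<close>.\<close>
lemma lee_curvature_eq_diff:
  "lee_curvature z v w = (\<Sum>i\<in>UNIV. Re (v $ Inl i) * Im (w $ Inl i) / (Im (z $ Inl i))\<^sup>2)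
    - (\<Sum>i\<in>UNIV. Re (w $ Inl i) * Im (v $ Inl i) / (Im (z $ Inl i))\<^sup>2)"
  by (simp add: lee_curvature_def diff_divide_distrib sum_subtractf mult.commute)

lemma lee_curvature_ii: "lee_curvature z (\<i> *s v) (\<i> *s w) = lee_curvature z v w"
  unfolding lee_curvature_def by (intro sum.cong) (auto simp: algebra_simps)

lemma has_derivative_Im_vec_nth [derivative_intros]:
  "((\<lambda>x :: complex^'n::finite. Im (x $ i)) has_derivative (\<lambda>h. Im (h $ i))) F"
  by (intro bounded_linear_imp_has_derivative bounded_linear_compose[OF bounded_linear_Im]
      bounded_linear_vec_nth)

lemma lee_cover_has_derivative:
  fixes z :: "complex^('s::finite + 't::finite)"
  assumes "z \<in> HC"
  shows "((\<lambda>x. lee_cover x w) has_derivative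
    (\<lambda>v. of_real (\<Sum>i\<in>UNIV. Im (w $ Inl i) * Im (v $ Inl i) / (Im (z $ Inl i))\<^sup>2))) (at z)"
proof -
  have pos: "Im (z $ Inl i) \<noteq> 0" for i
    using assms by (auto simp: HC_def dest: spec[of _ i])
  have "((\<lambda>x. complex_of_real (- (\<Sum>i\<in>UNIV. Im (w $ Inl i) / Im (x $ Inl i)))) has_derivative
    (\<lambda>v. of_real (\<Sum>i\<in>UNIV. Im (w $ Inl i) * Im (v $ Inl i) / (Im (z $ Inl i))\<^sup>2))) (at z)"
    using pos
    by (auto intro!: derivative_eq_intros sum.cong
        simp: sum_negf[symmetric] power2_eq_square divide_simps)
  then show ?thesis
    by (rule has_derivative_transform_within_open[OF _ open_HC assms]) (simp add: lee_cover_eq)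
qed

lemma log_phi_has_derivative:
  fixes z :: "complex^('s::finite + 't::finite)"
  assumes "z \<in> HC"
  shows "((\<lambda>x. complex_of_real (ln (phi x))) has_derivative lee_cover z) (at z)"
proof -
  have pos: "Im (z $ Inl i) > 0" for i
    using assms by (auto simp: HC_def)
  have "((\<lambda>x. complex_of_real (- (\<Sum>i\<in>UNIV. ln (Im (x $ Inl i))))) has_derivative lee_cover z) (at z)"
    unfolding lee_cover_eq[OF assms] using pos
    by (auto intro!: derivative_eq_intros sum.cong ext simp: divide_inverse)
  then show ?thesis
    by (rule has_derivative_transform_within_open[OF _ open_HC assms])
      (auto simp: phi_def HC_def ln_prod ln_inverse less_imp_neq[symmetric] sum_negf)
qed

text \<open>Here \<open>\<partial>bar log \<phi> = (\<theta> + \<i>\<theta>\<^sup>c)/2\<close>. The part \<open>\<theta>/2\<close> is closed, as its derivative \<open>?S\<close> is symmetric,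
  so only \<open>\<i> d\<theta>\<^sup>c/2\<close> remains; this form is already of type \<open>(1,1)\<close>.\<close>
lemma ddbar_log_phi:
  fixes z :: "complex^('s::finite + 't::finite)"
  assumes "z \<in> HC"
  shows "2 * \<i> * del01 (dbar (\<lambda>x. of_real (ln (phi x)))) z v w = of_real (lee_curvature z v w)"
proof -
  let ?\<beta> = "dbar (\<lambda>x :: complex^('s + 't). of_real (ln (phi x)))"
  let ?S = "\<lambda>v w. complex_of_real (\<Sum>i\<in>UNIV. Im (w $ Inl i) * Im (v $ Inl i) / (Im (z $ Inl i))\<^sup>2)"
    and ?T = "\<lambda>v w. complex_of_real (\<Sum>i\<in>UNIV. Re (w $ Inl i) * Im (v $ Inl i) / (Im (z $ Inl i))\<^sup>2)"
  have \<beta>: "(lee_cover x w + \<i> * lee_cover x (\<i> *s w)) / 2 = ?\<beta> x w" if "x \<in> HC" for x w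
    using frechet_derivative_at[OF log_phi_has_derivative[OF that]]
    by (simp add: dbar_def part01_def extd0_def)
  have "((\<lambda>x. (lee_cover x w + \<i> * lee_cover x (\<i> *s w)) / 2) has_derivative
      (\<lambda>v. (?S v w + \<i> * ?T v w) / 2)) (at z)" for w
  proof -
    have "((\<lambda>x. lee_cover x (\<i> *s w)) has_derivative (\<lambda>v. ?T v w)) (at z)"
      using lee_cover_has_derivative[OF assms, of "\<i> *s w"] by simp
    from bounded_linear.has_derivative[OF bounded_linear_divide has_derivative_add[OF
        lee_cover_has_derivative[OF assms] has_derivative_mult_right[OF this]]]
    show ?thesis .
  qed
  note \<beta>' = has_derivative_transform_within_open[OF this open_HC assms \<beta>]
  have D: "frechet_derivative (\<lambda>x. ?\<beta> x w) (at z) v = (?S v w + \<i> * ?T v w) / 2" for v w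
    by (rule fun_cong[OF frechet_derivative_at[OF \<beta>', symmetric]])
  have "?S v w = ?S w v" for v w
    by (simp add: mult.commute)
  then have "extd1 ?\<beta> z v w = - \<i> / 2 * (?T w v - ?T v w)" for v w
    unfolding extd1_def D by (simp add: field_simps)
  then have "extd1 ?\<beta> z v w = - \<i> / 2 * of_real (lee_curvature z v w)" for v w
    by (simp add: lee_curvature_eq_diff)
  then show ?thesis
    by (simp add: del01_def part11_def lee_curvature_ii)
qed

lemma lee_curvature_wedge:
  "of_real (lee_curvature z v w)
    = \<i> / 2 * (\<Sum>i\<in>UNIV. wedge (dz (Inl i)) (dzbar (Inl i)) z v w
                          / of_real (\<bar>Im (z $ Inl i)\<bar>\<^sup>2))"
  unfolding lee_curvature_def sum_distrib_left of_real_sum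
proof (intro sum.cong refl)
  fix i
  have "\<i> / 2 * wedge (dz (Inl i)) (dzbar (Inl i)) z v w
      = of_real (Re (v $ Inl i) * Im (w $ Inl i) - Im (v $ Inl i) * Re (w $ Inl i))"
    by (simp add: wedge_def dz_def dzbar_def complex_eq_iff)
  then show "complex_of_real ((Re (v $ Inl i) * Im (w $ Inl i) - Im (v $ Inl i) * Re (w $ Inl i)) / (Im (z $ Inl i))\<^sup>2)
    = \<i> / 2 * (wedge (dz (Inl i)) (dzbar (Inl i)) z v w / of_real (\<bar>Im (z $ Inl i)\<bar>\<^sup>2))"
    by (simp only: of_real_divide power2_abs times_divide_eq_right)
qed

text \<open>The linear combinations of powers of \<open>1 / Im z\<^sub>i\<close> are closed under directional derivatives: the
  exponent \<open>m\<close> goes up by one and the coefficients are rescaled.\<close>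
lemma smooth_on_inverse_Im_power:
  fixes c :: "'s::finite \<Rightarrow> real"
  shows "smooth_on (HC :: (complex^('s + 't::finite)) set)
    (\<lambda>z. complex_of_real (\<Sum>i\<in>UNIV. c i * inverse (Im (z $ Inl i)) ^ m))"
  unfolding smooth_on_def
proof
  fix k
  show "Ck_on k (HC :: (complex^('s + 't::finite)) set)
    (\<lambda>z. complex_of_real (\<Sum>i\<in>UNIV. c i * inverse (Im (z $ Inl i)) ^ m))"
  proof (induction k arbitrary: c m)
    case 0
    have "Im (z $ Inl i) \<noteq> 0" if "z \<in> HC" for z :: "complex^('s + 't)" and i
      using that by (auto simp: HC_def dest: spec[of _ i])
    then show ?case
      by (auto intro!: continuous_intros)
  next
    case (Suc k)
    let ?f = "\<lambda>z :: complex^('s + 't). complex_of_real (\<Sum>i\<in>UNIV. c i * inverse (Im (z $ Inl i)) ^ m)"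
    let ?f' = "\<lambda>(z :: complex^('s + 't)) (v :: complex^('s + 't)). complex_of_real
      (\<Sum>i\<in>UNIV. (- (real m * c i * Im (v $ Inl i))) * inverse (Im (z $ Inl i)) ^ Suc m)"
    have D: "(?f has_derivative ?f' z) (at z)" if "z \<in> HC" for z
    proof -
      have pos: "Im (z $ Inl i) \<noteq> 0" for i
        using that by (auto simp: HC_def dest: spec[of _ i])
      have "((\<lambda>z :: complex^('s + 't). c i * inverse (Im (z $ Inl i)) ^ m) has_derivative
          (\<lambda>v. (- (real m * c i * Im (v $ Inl i))) * inverse (Im (z $ Inl i)) ^ Suc m)) (at z)" for i
      proof -
        have "((\<lambda>z :: complex^('s + 't). inverse (Im (z $ Inl i))) has_derivative
            (\<lambda>v. - (inverse (Im (z $ Inl i)) * Im (v $ Inl i) * inverse (Im (z $ Inl i))))) (at z)"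
          using pos by (intro Deriv.has_derivative_inverse has_derivative_Im_vec_nth)
        from has_derivative_mult_right[OF has_derivative_power[OF this], of "c i" m]
        show ?thesis
          by (rule has_derivative_eq_rhs) (cases m; simp add: fun_eq_iff mult_ac)
      qed
      then show ?thesis
        by (intro has_derivative_of_real has_derivative_sum)
    qed
    have "Ck_on k HC (\<lambda>z. frechet_derivative ?f (at z) v)" for v
    proof (rule Ck_on_cong[OF open_HC])
      show "Ck_on k HC (\<lambda>z. ?f' z v)" using Suc.IH[of "\<lambda>i. - (real m * c i * Im (v $ Inl i))" "Suc m"] .
      show "?f' z v = frechet_derivative ?f (at z) v" if "z \<in> HC" for z
        using frechet_derivative_at[OF D[OF that]] by (rule fun_cong)
    qed
    then show ?case
      using D unfolding differentiable_def Ck_on.simps by blast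
  qed
qed

lemma lee_curvature_smooth:
  fixes v w :: "complex^('s::finite + 't::finite)"
  shows "smooth_on HC (\<lambda>z. complex_of_real (lee_curvature z v w))"
  using smooth_on_inverse_Im_power[of "\<lambda>i. Re (v $ Inl i) * Im (w $ Inl i) - Im (v $ Inl i) * Re (w $ Inl i)" 2]
  by (simp add: lee_curvature_def divide_inverse power_inverse)

lemma lee_curvature_antisym: "lee_curvature z w v = - lee_curvature z v w"
  by (simp add: lee_curvature_eq_diff)

lemma lee_curvature_bilinear:
  "bilinear (\<lambda>v w. complex_of_real (lee_curvature z v w))"
proof -
  have add: "lee_curvature z (v + v') w = lee_curvature z v w + lee_curvature z v' w" for v v' w
    unfolding lee_curvature_def sum.distrib[symmetric]
    by (intro sum.cong refl) (simp add: add_divide_distrib[symmetric] algebra_simps)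
  have scale: "lee_curvature z (r *\<^sub>R v) w = r * lee_curvature z v w" for r v w
    unfolding lee_curvature_def sum_distrib_left
    by (intro sum.cong refl) (simp add: algebra_simps)
  have "linear (\<lambda>v. complex_of_real (lee_curvature z v w))" for w
    by (rule linearI) (simp_all add: add scale scaleR_conv_of_real[where 'a = complex])
  moreover have "(\<lambda>w. complex_of_real (lee_curvature z v w))
      = (\<lambda>w. - complex_of_real (lee_curvature z w v))" for v
    using lee_curvature_antisym[of z v] by simp
  ultimately show ?thesis
    unfolding bilinear_def by (metis linear_compose_neg)
qed

context
  fixes \<sigma> :: "'s::finite + 't::finite \<Rightarrow> 'k::field_char_0 \<Rightarrow> complex" and U :: "'k set"
  assumes emb: "all_embeddings \<sigma>" and adm: "admissible \<sigma> U"
begin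

lemma ot_pull0_act:
  assumes "g \<in> ot_group U"
  shows "ot_pull0 \<sigma> U f (ot_act \<sigma> g z) = ot_pull0 \<sigma> U f z"
  by (simp add: ot_pull0_def ot_proj_act[OF emb adm assms])

lemma ot_pull1_act:
  assumes "g \<in> ot_group U"
  shows "ot_pull1 \<sigma> U \<alpha> (ot_act \<sigma> g z) (ot_dact \<sigma> g v) = ot_pull1 \<sigma> U \<alpha> z v"
  by (simp add: ot_pull1_def ot_proj_act[OF emb adm assms] ot_dproj_act[OF emb adm assms])

lemma weight_nabla0_pullback:
  assumes "ot_smooth \<sigma> U f" "z \<in> HC"
  shows "ot_pull1 \<sigma> U (weight_nabla0 \<sigma> U f) z v
    = extd0 (ot_pull0 \<sigma> U f) z v + ot_pull0 \<sigma> U f z * (\<i> * lee_cover z (\<i> *s v))"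
proof -
  have diff: "ot_pull0 \<sigma> U f differentiable (at x)" if "x \<in> HC" for x
    using smooth_onD(1)[OF assms(1)[unfolded ot_smooth_def] that] by (auto simp: differentiable_def)
  have "ot_d0 \<sigma> U f (ot_proj \<sigma> U z) (ot_dproj \<sigma> U z v) = extd0 (ot_pull0 \<sigma> U f) z v"
    unfolding ot_d0_def
  proof (rule ot_descend1_proj[OF emb adm])
    fix g assume g: "g \<in> ot_group U"
    show "extd0 (ot_pull0 \<sigma> U f) (ot_act \<sigma> g z) (ot_dact \<sigma> g v) = extd0 (ot_pull0 \<sigma> U f) z v"
      unfolding extd0_def
      by (rule frechet_derivative_act[OF emb adm assms(2)])
        (simp_all add: ot_pull0_act[OF g] diff lee_cover_invariant(1)[OF emb adm g assms(2)])
  qed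
  then show ?thesis
    using lee_form_pullback[OF emb adm assms(2), of "\<i> *s v"]
    by (simp add: ot_pull1_def weight_nabla0_def lee_form_c_def ot_I_def ot_J_dproj ot_pull0_def)
qed

lemma weight_nabla0_has_derivative:
  assumes f: "ot_smooth \<sigma> U f" and z: "z \<in> HC"
  shows "((\<lambda>x. ot_pull1 \<sigma> U (weight_nabla0 \<sigma> U f) x w) has_derivative
    (\<lambda>v. frechet_derivative (\<lambda>x. extd0 (ot_pull0 \<sigma> U f) x w) (at z) v
      + (ot_pull0 \<sigma> U f z * (\<i> * of_real (\<Sum>i\<in>UNIV. Re (w $ Inl i) * Im (v $ Inl i) / (Im (z $ Inl i))\<^sup>2))
        + extd0 (ot_pull0 \<sigma> U f) z v * (\<i> * lee_cover z (\<i> *s w))))) (at z)"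
proof -
  note s = smooth_onD[OF f[unfolded ot_smooth_def]]
  have "((\<lambda>x. extd0 (ot_pull0 \<sigma> U f) x w) has_derivative
      frechet_derivative (\<lambda>x. extd0 (ot_pull0 \<sigma> U f) x w) (at z)) (at z)"
    unfolding extd0_def by (rule smooth_onD(1)[OF s(2) z])
  moreover have "(ot_pull0 \<sigma> U f has_derivative extd0 (ot_pull0 \<sigma> U f) z) (at z)"
    using s(1)[OF z] by (simp add: extd0_def[abs_def])
  moreover have "((\<lambda>x. lee_cover x (\<i> *s w)) has_derivative
      (\<lambda>v. of_real (\<Sum>i\<in>UNIV. Re (w $ Inl i) * Im (v $ Inl i) / (Im (z $ Inl i))\<^sup>2))) (at z)"
    using lee_cover_has_derivative[OF z, of "\<i> *s w"] by simp
  ultimately have "((\<lambda>x. extd0 (ot_pull0 \<sigma> U f) x w + ot_pull0 \<sigma> U f x * (\<i> * lee_cover x (\<i> *s w)))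
    has_derivative
    (\<lambda>v. frechet_derivative (\<lambda>x. extd0 (ot_pull0 \<sigma> U f) x w) (at z) v
      + (ot_pull0 \<sigma> U f z * (\<i> * of_real (\<Sum>i\<in>UNIV. Re (w $ Inl i) * Im (v $ Inl i) / (Im (z $ Inl i))\<^sup>2))
        + extd0 (ot_pull0 \<sigma> U f) z v * (\<i> * lee_cover z (\<i> *s w))))) (at z)"
    by (intro has_derivative_add has_derivative_mult has_derivative_mult_right)
  then show ?thesis
    by (rule has_derivative_transform_within_open[OF _ open_HC z])
      (simp add: weight_nabla0_pullback[OF f])
qed

text \<open>The computation \<open>\<nabla>\<^sup>2f = f \<i> d\<theta>\<^sup>c\<close>: writing \<open>\<alpha> = df + f \<i>\<theta>\<^sup>c\<close>, the Leibniz terms of \<open>d\<alpha>\<close> are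
  cancelled by \<open>\<i>\<theta>\<^sup>c \<and> \<alpha>\<close>.\<close>
lemma weight_nabla_sq_pullback:
  assumes f: "ot_smooth \<sigma> U f" and z: "z \<in> HC"
  shows "\<i> * ot_pull2 \<sigma> U (weight_nabla_sq \<sigma> U f) z v w
    = of_real (lee_curvature z v w) * ot_pull0 \<sigma> U f z"
proof -
  let ?\<alpha> = "ot_pull1 \<sigma> U (weight_nabla0 \<sigma> U f)" and ?F = "ot_pull0 \<sigma> U f"
  let ?S = "\<lambda>v w. complex_of_real (\<Sum>i\<in>UNIV. Re (w $ Inl i) * Im (v $ Inl i) / (Im (z $ Inl i))\<^sup>2)"
  have "ot_d1 \<sigma> U (weight_nabla0 \<sigma> U f) (ot_proj \<sigma> U z) (ot_dproj \<sigma> U z v) (ot_dproj \<sigma> U z w)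
      = extd1 ?\<alpha> z v w"
    unfolding ot_d1_def
  proof (rule ot_descend2_proj[OF emb adm z])
    fix g assume g: "g \<in> ot_group U"
    show "extd1 ?\<alpha> (ot_act \<sigma> g z) (ot_dact \<sigma> g v) (ot_dact \<sigma> g w) = extd1 ?\<alpha> z v w"
      using weight_nabla0_has_derivative[OF f]
      by (intro extd1_act[OF emb adm g z]) (auto simp: ot_pull1_act[OF g] differentiable_def)
  qed
  moreover have "ot_wedge (\<lambda>q Z. \<i> * lee_form_c q Z) (weight_nabla0 \<sigma> U f)
      (ot_proj \<sigma> U z) (ot_dproj \<sigma> U z v) (ot_dproj \<sigma> U z w)
      = \<i> * lee_cover z (\<i> *s v) * ?\<alpha> z w - \<i> * lee_cover z (\<i> *s w) * ?\<alpha> z v"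
    using lee_form_pullback[OF emb adm z, of "\<i> *s v"] lee_form_pullback[OF emb adm z, of "\<i> *s w"]
    by (simp add: ot_wedge_def ot_pull1_def lee_form_c_def ot_I_def ot_J_dproj)
  ultimately have pull: "ot_pull2 \<sigma> U (weight_nabla_sq \<sigma> U f) z v w = extd1 ?\<alpha> z v w
      + (\<i> * lee_cover z (\<i> *s v) * ?\<alpha> z w - \<i> * lee_cover z (\<i> *s w) * ?\<alpha> z v)"
    by (simp add: ot_pull2_def weight_nabla_sq_def weight_nabla1_def)
  have D: "frechet_derivative (\<lambda>x. ?\<alpha> x w) (at z) v
      = frechet_derivative (\<lambda>x. extd0 ?F x w) (at z) v
        + (?F z * (\<i> * ?S v w)
          + extd0 ?F z v * (\<i> * lee_cover z (\<i> *s w)))" for v w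
    by (rule fun_cong[OF frechet_derivative_at[OF weight_nabla0_has_derivative[OF f z], symmetric]])
  have split_diff: "a + (b + c) - (a' + (b' + c')) = a - a' + b - b' + (c - c')"
    for a b c a' b' c' :: complex
    by simp
  have E: "extd1 ?\<alpha> z v w = extd1 (extd0 ?F) z v w
      + ?F z * (\<i> * ?S v w)
      - ?F z * (\<i> * ?S w v)
      + (extd0 ?F z v * (\<i> * lee_cover z (\<i> *s w)) - extd0 ?F z w * (\<i> * lee_cover z (\<i> *s v)))"
    unfolding extd1_def D by (rule split_diff)
  have dd: "extd1 (extd0 ?F) z v w = 0"
    using extd1_extd0[OF open_HC f[unfolded ot_smooth_def] z] .
  \<comment> \<open>\<open>S\<close> and \<open>S'\<close> are derivatives of \<open>\<theta>\<^sup>c\<close>; \<open>l\<close>, \<open>m\<close> its values and \<open>a\<close>, \<open>b\<close> those of \<open>df\<close> at \<open>v\<close>, \<open>w\<close>\<close>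
  have alg: "0 + F * (\<i> * S) - F * (\<i> * S') + (a * (\<i> * m) - b * (\<i> * l))
      + (\<i> * l * (b + F * (\<i> * m)) - \<i> * m * (a + F * (\<i> * l))) = - \<i> * ((S' - S) * F)"
    for F S S' a b l m :: complex
    by (simp add: algebra_simps)
  have "ot_pull2 \<sigma> U (weight_nabla_sq \<sigma> U f) z v w = - \<i> * ((?S w v - ?S v w) * ?F z)"
    unfolding pull E dd weight_nabla0_pullback[OF f z] by (rule alg)
  also have "?S w v - ?S v w = of_real (lee_curvature z v w)"
    by (simp add: lee_curvature_eq_diff)
  finally have "\<i> * ot_pull2 \<sigma> U (weight_nabla_sq \<sigma> U f) z v w
      = - (\<i> * \<i>) * (of_real (lee_curvature z v w) * ?F z)"
    by (simp only: mult.assoc mult_minus_left mult_minus_right)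
  then show ?thesis by simp
qed

lemma omega0_pullback:
  assumes "z \<in> HC"
  shows "ot_pull2 \<sigma> U (omega0 \<sigma> U) z v w = of_real (lee_curvature z v w)"
proof -
  have "ot_smooth \<sigma> U (\<lambda>_. 1)"
    by (simp add: ot_smooth_def smooth_on_def ot_pull0_def[abs_def] Ck_on_const)
  from weight_nabla_sq_pullback[OF this assms, of v w] show ?thesis
    by (simp add: ot_pull2_def omega0_def ot_pull0_def)
qed

lemma omega0_is_i_nabla_sq: "is_i_nabla_sq \<sigma> U (omega0 \<sigma> U)"
  unfolding is_i_nabla_sq_def
proof (intro conjI allI impI ballI)
  have "ot_pull2 \<sigma> U (omega0 \<sigma> U) z = (\<lambda>v w. of_real (lee_curvature z v w))" if "z \<in> HC" for z
    by (simp add: fun_eq_iff omega0_pullback[OF that])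
  moreover have "smooth_on HC (\<lambda>z. ot_pull2 \<sigma> U (omega0 \<sigma> U) z v w)" for v w
    by (subst smooth_on_cong[OF open_HC, where g = "\<lambda>z. complex_of_real (lee_curvature z v w)"])
      (simp_all add: omega0_pullback lee_curvature_smooth)
  ultimately show "ot_smooth_form2 \<sigma> U (omega0 \<sigma> U)"
    by (simp add: ot_smooth_form2_def lee_curvature_bilinear) (simp add: lee_curvature_def)
next
  fix f p X Y
  assume f: "ot_smooth \<sigma> U f" and p: "p \<in> ot_manifold \<sigma> U"
    and X: "X \<in> ot_tangent \<sigma> U p" and Y: "Y \<in> ot_tangent \<sigma> U p"
  obtain z where z: "z \<in> HC" "p = ot_proj \<sigma> U z"
    using p by (auto simp: ot_manifold_def)
  obtain v w where XY: "X = ot_dproj \<sigma> U z v" "Y = ot_dproj \<sigma> U z w"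
    using ot_tangent_proj[OF emb adm X[unfolded z(2)]] ot_tangent_proj[OF emb adm Y[unfolded z(2)]]
    by metis
  show "\<i> * weight_nabla_sq \<sigma> U f p X Y = omega0 \<sigma> U p X Y * f p"
    using weight_nabla_sq_pullback[OF f z(1), of v w, folded omega0_pullback[OF z(1)]]
    unfolding z(2) XY ot_pull2_def ot_pull0_def .
qed

lemma omega0_semi_positive: "ot_semi_positive \<sigma> U (omega0 \<sigma> U)"
  unfolding ot_semi_positive_def
proof (intro ballI)
  fix p X Y
  assume p: "p \<in> ot_manifold \<sigma> U"
    and X: "X \<in> ot_tangent \<sigma> U p" and Y: "Y \<in> ot_tangent \<sigma> U p"
  obtain z where z: "z \<in> HC" "p = ot_proj \<sigma> U z"
    using p by (auto simp: ot_manifold_def)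
  obtain v w where XY: "X = ot_dproj \<sigma> U z v" "Y = ot_dproj \<sigma> U z w"
    using ot_tangent_proj[OF emb adm X[unfolded z(2)]] ot_tangent_proj[OF emb adm Y[unfolded z(2)]]
    by metis
  note eq = omega0_pullback[OF z(1), unfolded ot_pull2_def]
  have "lee_curvature z v (\<i> *s v) \<ge> 0"
    unfolding lee_curvature_def by (intro sum_nonneg) simp
  then show "omega0 \<sigma> U p X Y \<in> \<real> \<and> omega0 \<sigma> U p (ot_J X) (ot_J Y) = omega0 \<sigma> U p X Y \<and>
      0 \<le> Re (omega0 \<sigma> U p X (ot_J X))"
    by (simp add: z(2) XY ot_J_dproj eq lee_curvature_ii)
qed

end

theorem theorem2p4:
  fixes \<sigma> :: "'s::finite + 't::finite \<Rightarrow> 'k::field_char_0 \<Rightarrow> complex"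
    and U :: "'k set"
  assumes "rat_degree TYPE('k) = CARD('s) + 2 * CARD('t)"
    and "all_embeddings \<sigma>"
    and "admissible \<sigma> U"
  shows "is_i_nabla_sq \<sigma> U (omega0 \<sigma> U) \<and>
    ot_semi_positive \<sigma> U (omega0 \<sigma> U) \<and>
    (\<forall>z\<in>HC. \<forall>v w.
       ot_pull2 \<sigma> U (omega0 \<sigma> U) z v w
         = 2 * \<i> * del01 (dbar (\<lambda>x. of_real (ln (phi x)))) z v w \<and>
       ot_pull2 \<sigma> U (omega0 \<sigma> U) z v w
         = \<i> / 2 * (\<Sum>i\<in>UNIV. wedge (dz (Inl i)) (dzbar (Inl i)) z v w
                          / of_real (\<bar>Im (z $ Inl i)\<bar>\<^sup>2)))"
proof (intro conjI ballI allI)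
  show "is_i_nabla_sq \<sigma> U (omega0 \<sigma> U)" "ot_semi_positive \<sigma> U (omega0 \<sigma> U)"
    using omega0_is_i_nabla_sq omega0_semi_positive assms by blast+
  fix z v w :: "complex^('s + 't)"
  assume z: "z \<in> HC"
  note pull = omega0_pullback[OF assms(2,3) z, of v w]
  show "ot_pull2 \<sigma> U (omega0 \<sigma> U) z v w = 2 * \<i> * del01 (dbar (\<lambda>x. of_real (ln (phi x)))) z v w"
    unfolding pull ddbar_log_phi[OF z] ..
  show "ot_pull2 \<sigma> U (omega0 \<sigma> U) z v w
      = \<i> / 2 * (\<Sum>i\<in>UNIV. wedge (dz (Inl i)) (dzbar (Inl i)) z v w
                          / of_real (\<bar>Im (z $ Inl i)\<bar>\<^sup>2))"
    using pull lee_curvature_wedge[of z v w] by (rule trans)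
qed

end
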